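(* Let $d\ge1$, let $\alpha$ be an absolutely continuous real random variable on a probability space $(\Omega,\mathcal{F},\mathbb{P})$, let $G\subset\mathbb{R}^d$ be a bounded Lipschitz domain, let $G_0\subset G$ be a measurable subset of strictly positive Lebesgue measure, and let $T>0$. Then the random Schrödinger system $$\partial_t y-\alpha\,\mathrm{i}\Delta y=\mathbf{1}_{G_0}u \ \text{ on }(0,T)\times G,\qquad y=0\ \text{ on }(0,T)\times\partial G,\qquad y(0,\cdot)=y_0\ \text{ in }G$$ is not exactly controllable in average in the space $L^2(G)$ with controls acting in $L^2(0,T;L^2(G_0))$.
   Context: All function spaces are complex valued; $\|\cdot\|$ is the norm of $L^2(G)=L^2(G;\mathbb{C})$. The real random variable $\alpha$ has distribution $\mu_\alpha=\mathbb{P}\circ\alpha^{-1}$; it is absolutely continuous if $\mu_\alpha$ has a density $\rho_\alpha\in L^1(\mathbb{R})$ with respect to Lebesgue measure. $\Delta$ is the Laplacian on $L^2(G)$ with Dirichlet boundary conditions and $(e^{\mathrm{i}t\Delta})_{t\in\mathbb{R}}$ the unitary group generated by $\mathrm{i}\Delta$. For $\xi\in\mathbb{R}$, $y_0\in L^2(G)$ and $u\in L^2((0,T)\times G_0)$ (both $y_0$ and $u$ independent of $\omega\in\Omega$), the solution of the system with $\alpha$ replaced by $\xi$ is $y(t,\cdot;\xi;y_0;u)=e^{\mathrm{i}t\xi\Delta}y_0+\int_0^t e^{\mathrm{i}(t-s)\xi\Delta}\mathbf{1}_{G_0}u(s,\cdot)\,ds\in C([0,T];L^2(G))$. Its average is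 $\mathbb{E}(y(t,\cdot;\alpha;y_0;u))=\int_\Omega y(t,\cdot;\alpha(\omega);y_0;u)\,d\mathbb{P}(\omega)=\int_{\mathbb{R}}y(t,\cdot;\xi;y_0;u)\,d\mu_\alpha(\xi)$. The system is exactly controllable in average in $L^2(G)$ (with controls in $L^2(0,T;L^2(G_0))$) if there is a constant $C_{ex}>0$ such that for all $y_0,y_1\in L^2(G)$ there exists $u\in L^2((0,T)\times G_0)$ with $\|u\|_{L^2((0,T)\times G_0)}\le C_{ex}(\|y_0\|+\|y_1\|)$ and $\mathbb{E}(y(T,\cdot;\alpha;y_0;u))=y_1$. *)

theory Defs
  imports "HOL-Probability.Probability"
begin

section \<open>The space of complex square-integrable functions modulo null sets\<close>

text \<open>The type \<open>'a L2\<close> is made a separable real Hilbert space (the inner product is the real part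
  of the usual Hermitian one), so that the library's Bochner integral applies to functions with
  values in it. The space over a measurable set \<open>A\<close> is the closed subspace \<open>L2_on A\<close> of the
  functions vanishing almost everywhere outside \<open>A\<close>.\<close>


definition square_integrable :: "('a::euclidean_space \<Rightarrow> complex) \<Rightarrow> bool" where
  "square_integrable f \<longleftrightarrow>
     f \<in> borel_measurable lebesgue \<and> integrable lebesgue (\<lambda>x. (cmod (f x))\<^sup>2)"

lemma square_integrable_zero: "square_integrable (\<lambda>x. 0)"
  by (simp add: square_integrable_def)

lemma square_integrable_scaleC:
  assumes "square_integrable f"
  shows "square_integrable (\<lambda>x. c * f x)"
  using assms by (auto simp: square_integrable_def norm_mult power_mult_distrib)

lemma square_integrable_add:
  assumes "square_integrable f" "square_integrable g"
  shows "square_integrable (\<lambda>x. f x + g x)"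
proof -
  have [measurable]: "f \<in> borel_measurable lebesgue" "g \<in> borel_measurable lebesgue"
    using assms by (auto simp: square_integrable_def)
  have "integrable lebesgue (\<lambda>x. 2 * (cmod (f x))\<^sup>2 + 2 * (cmod (g x))\<^sup>2)"
    using assms by (auto simp: square_integrable_def)
  then have "integrable lebesgue (\<lambda>x. (cmod (f x + g x))\<^sup>2)"
  proof (rule Bochner_Integration.integrable_bound)
    show "AE x in lebesgue. norm ((cmod (f x + g x))\<^sup>2)
            \<le> norm (2 * (cmod (f x))\<^sup>2 + 2 * (cmod (g x))\<^sup>2)"
    proof (rule AE_I2)
      fix x
      have "(cmod (f x + g x))\<^sup>2 \<le> (cmod (f x) + cmod (g x))\<^sup>2"
        by (intro power_mono norm_triangle_ineq) auto
      also have "\<dots> \<le> 2 * (cmod (f x))\<^sup>2 + 2 * (cmod (g x))\<^sup>2"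
        using sum_squares_bound[of "cmod (f x)" "cmod (g x)"] by (simp add: power2_sum)
      finally show "norm ((cmod (f x + g x))\<^sup>2)
            \<le> norm (2 * (cmod (f x))\<^sup>2 + 2 * (cmod (g x))\<^sup>2)" by simp
    qed
  qed measurable
  then show ?thesis by (simp add: square_integrable_def)
qed

lemma square_integrable_diff:
  assumes "square_integrable f" "square_integrable g"
  shows "square_integrable (\<lambda>x. f x - g x)"
  using square_integrable_add[OF assms(1) square_integrable_scaleC[OF assms(2), of "-1"]] by simp

lemma integrable_inner_square_integrable:
  assumes "square_integrable f" "square_integrable g"
  shows "integrable lebesgue (\<lambda>x. f x \<bullet> g x)"
proof -
  have [measurable]: "f \<in> borel_measurable lebesgue" "g \<in> borel_measurable lebesgue"
    using assms by (auto simp: square_integrable_def)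
  have "integrable lebesgue (\<lambda>x. (cmod (f x))\<^sup>2 + (cmod (g x))\<^sup>2)"
    using assms by (auto simp: square_integrable_def)
  then show ?thesis
  proof (rule Bochner_Integration.integrable_bound)
    show "AE x in lebesgue. norm (f x \<bullet> g x) \<le> norm ((cmod (f x))\<^sup>2 + (cmod (g x))\<^sup>2)"
    proof (rule AE_I2)
      fix x
      have "\<bar>f x \<bullet> g x\<bar> \<le> cmod (f x) * cmod (g x)" by (rule Cauchy_Schwarz_ineq2)
      also have "\<dots> \<le> (cmod (f x))\<^sup>2 + (cmod (g x))\<^sup>2"
        using sum_squares_bound[of "cmod (f x)" "cmod (g x)"]
          zero_le_power2[of "cmod (f x)"] zero_le_power2[of "cmod (g x)"] by linarith
      finally show "norm (f x \<bullet> g x) \<le> norm ((cmod (f x))\<^sup>2 + (cmod (g x))\<^sup>2)" by simp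
    qed
  qed measurable
qed

definition L2_rel :: "('a::euclidean_space \<Rightarrow> complex) \<Rightarrow> ('a \<Rightarrow> complex) \<Rightarrow> bool" where
  "L2_rel f g \<longleftrightarrow>
     square_integrable f \<and> square_integrable g \<and> (AE x in lebesgue. f x = g x)"

quotient_type (overloaded) 'a L2 = "'a::euclidean_space \<Rightarrow> complex" / partial: L2_rel
proof (rule part_equivpI)
  show "\<exists>f. L2_rel f f"
    using square_integrable_zero by (auto simp: L2_rel_def)
  show "symp L2_rel"
    by (auto simp: L2_rel_def symp_def elim: eventually_mono)
  show "transp L2_rel"
    by (auto simp: L2_rel_def transp_def elim: eventually_elim2)
qed

text \<open>The class of a square-integrable function; functions that are not square integrable
  are sent to \<open>0\<close>.\<close>

definition L2_of :: "('a::euclidean_space \<Rightarrow> complex) \<Rightarrow> 'a L2" where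
  "L2_of f = (if square_integrable f then abs_L2 f else abs_L2 (\<lambda>x. 0))"

lemma square_integrable_rep [simp]: "square_integrable (rep_L2 f)"
  using Quotient3_rep_reflp[OF Quotient3_L2] by (auto simp: L2_rel_def)

lemma L2_of_rep [simp]: "L2_of (rep_L2 f) = f"
  using Quotient3_abs_rep[OF Quotient3_L2] by (auto simp: L2_of_def)

lemma rep_L2_of:
  assumes "square_integrable f"
  shows "AE x in lebesgue. rep_L2 (L2_of f) x = f x"
proof -
  have "L2_rel f f" using assms by (simp add: L2_rel_def)
  then have "L2_rel (rep_L2 (abs_L2 f)) f"
    by (metis Quotient3_L2 rep_abs_rsp_left)
  then show ?thesis using assms by (simp add: L2_of_def L2_rel_def)
qed

lemma L2_eq_iff: "f = g \<longleftrightarrow> (AE x in lebesgue. rep_L2 f x = rep_L2 g x)"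
  using Quotient3_rel_rep[OF Quotient3_L2, of f g] by (auto simp: L2_rel_def)

instantiation L2 :: (euclidean_space) real_inner
begin

lift_definition zero_L2 :: "'a L2" is "\<lambda>x. 0"
  using square_integrable_zero by (auto simp: L2_rel_def)

lift_definition plus_L2 :: "'a L2 \<Rightarrow> 'a L2 \<Rightarrow> 'a L2" is "\<lambda>f g x. f x + g x"
  using square_integrable_add by (auto simp: L2_rel_def elim: eventually_elim2)

lift_definition minus_L2 :: "'a L2 \<Rightarrow> 'a L2 \<Rightarrow> 'a L2" is "\<lambda>f g x. f x - g x"
  using square_integrable_diff by (auto simp: L2_rel_def elim: eventually_elim2)

lift_definition uminus_L2 :: "'a L2 \<Rightarrow> 'a L2" is "\<lambda>f x. - f x"
  using square_integrable_scaleC[where c = "-1"] by (auto simp: L2_rel_def elim: eventually_mono)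

lift_definition scaleR_L2 :: "real \<Rightarrow> 'a L2 \<Rightarrow> 'a L2" is "\<lambda>r f x. of_real r * f x"
  using square_integrable_scaleC by (auto simp: L2_rel_def elim: eventually_mono)

lift_definition inner_L2 :: "'a L2 \<Rightarrow> 'a L2 \<Rightarrow> real" is "\<lambda>f g. LINT x|lebesgue. f x \<bullet> g x"
proof -
  fix f f' g g' :: "'a \<Rightarrow> complex"
  assume *: "L2_rel f f'" "L2_rel g g'"
  then have "AE x in lebesgue. f x \<bullet> g x = f' x \<bullet> g' x"
    by (auto simp: L2_rel_def elim: eventually_elim2)
  with * show "(LINT x|lebesgue. f x \<bullet> g x) = (LINT x|lebesgue. f' x \<bullet> g' x)"
    by (intro integral_cong_AE) (auto simp: L2_rel_def square_integrable_def)
qed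

definition norm_L2 :: "'a L2 \<Rightarrow> real" where "norm_L2 f = sqrt (f \<bullet> f)"
definition sgn_L2 :: "'a L2 \<Rightarrow> 'a L2" where "sgn_L2 f = inverse (norm f) *\<^sub>R f"
definition dist_L2 :: "'a L2 \<Rightarrow> 'a L2 \<Rightarrow> real" where "dist_L2 f g = norm (f - g)"
definition uniformity_L2 :: "('a L2 \<times> 'a L2) filter" where
  "uniformity_L2 = (INF e\<in>{0<..}. principal {(f, g). dist f g < e})"
definition open_L2 :: "'a L2 set \<Rightarrow> bool" where
  "open_L2 U \<longleftrightarrow> (\<forall>x\<in>U. eventually (\<lambda>(x', y). x' = x \<longrightarrow> y \<in> U) uniformity)"

instance
proof
  fix f g h :: "'a L2" and a b :: real
  show "f + g + h = f + (g + h)" 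
    by transfer (auto simp: L2_rel_def add.assoc intro!: square_integrable_add)
  show "f + g = g + f"
    by transfer (auto simp: L2_rel_def add.commute intro!: square_integrable_add)
  show "0 + f = f" by transfer (auto simp: L2_rel_def)
  show "- f + f = 0" by transfer (auto simp: L2_rel_def square_integrable_zero)
  show "f - g = f + - g" 
    by transfer (auto simp: L2_rel_def square_integrable_diff)
  show "a *\<^sub>R (f + g) = a *\<^sub>R f + a *\<^sub>R g"
    by transfer (auto simp: L2_rel_def distrib_left distrib_right mult.assoc
        intro!: square_integrable_add square_integrable_scaleC)
  show "(a + b) *\<^sub>R f = a *\<^sub>R f + b *\<^sub>R f"
    by transfer (auto simp: L2_rel_def distrib_left distrib_right mult.assoc
        intro!: square_integrable_add square_integrable_scaleC)
  show "a *\<^sub>R b *\<^sub>R f = (a * b) *\<^sub>R f"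
    by transfer (auto simp: L2_rel_def distrib_left distrib_right mult.assoc
        intro!: square_integrable_add square_integrable_scaleC)
  show "1 *\<^sub>R f = f" by transfer (auto simp: L2_rel_def)
  show "sgn f = inverse (norm f) *\<^sub>R f" by (rule sgn_L2_def)
  show "dist f g = norm (f - g)" by (rule dist_L2_def)
  show "uniformity = (INF e\<in>{0<..}. principal {(f, g :: 'a L2). dist f g < e})"
    by (rule uniformity_L2_def)
  show "norm f = sqrt (f \<bullet> f)" by (rule norm_L2_def)
  show "f \<bullet> g = g \<bullet> f" by transfer (simp add: inner_commute)
  show "(f + g) \<bullet> h = f \<bullet> h + g \<bullet> h"
    by transfer (simp add: L2_rel_def inner_add_left integrable_inner_square_integrable)
  show "(a *\<^sub>R f) \<bullet> g = a * (f \<bullet> g)"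
    by transfer (simp flip: scaleR_conv_of_real)
  show "0 \<le> f \<bullet> f" by transfer simp
  show "(f \<bullet> f = 0) = (f = 0)"
  proof transfer
    fix f :: "'a \<Rightarrow> complex" assume "L2_rel f f"
    then have f: "square_integrable f" by (simp add: L2_rel_def)
    have "((LINT x|lebesgue. f x \<bullet> f x) = 0) \<longleftrightarrow> (AE x in lebesgue. f x \<bullet> f x = 0)"
      by (intro integral_nonneg_eq_0_iff_AE integrable_inner_square_integrable f) auto
    then show "((LINT x|lebesgue. f x \<bullet> f x) = 0) = L2_rel f (\<lambda>x. 0)"
      using f by (simp add: L2_rel_def square_integrable_zero)
  qed
next
  fix U :: "'a L2 set"
  show "open U = (\<forall>x\<in>U. \<forall>\<^sub>F (x', y) in uniformity. x' = x \<longrightarrow> y \<in> U)"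
    by (rule open_L2_def)
qed

end

lemma norm_L2_of:
  assumes "square_integrable f"
  shows "(norm (L2_of f))\<^sup>2 = (LINT x|lebesgue. (cmod (f x))\<^sup>2)"
proof -
  have "L2_of f \<bullet> L2_of f = (LINT x|lebesgue. f x \<bullet> f x)"
    using assms unfolding L2_of_def by (simp add: inner_L2.abs_eq L2_rel_def)
  then show ?thesis
    by (simp add: power2_norm_eq_inner)
qed

lemma L2_of_add:
  "square_integrable f \<Longrightarrow> square_integrable g \<Longrightarrow> L2_of (\<lambda>x. f x + g x) = L2_of f + L2_of g"
  by (simp add: L2_of_def square_integrable_add plus_L2.abs_eq L2_rel_def)

lemma L2_of_diff:
  "square_integrable f \<Longrightarrow> square_integrable g \<Longrightarrow> L2_of (\<lambda>x. f x - g x) = L2_of f - L2_of g"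
  by (simp add: L2_of_def square_integrable_diff minus_L2.abs_eq L2_rel_def)

lemma L2_of_zero [simp]: "L2_of (\<lambda>x. 0) = 0"
  by (simp add: L2_of_def zero_L2_def square_integrable_zero)


lemma nn_integral_rep_diff:
  "(\<integral>\<^sup>+x. ennreal ((cmod (rep_L2 f x - rep_L2 g x))\<^sup>2) \<partial>lebesgue) = ennreal ((norm (f - g))\<^sup>2)"
proof -
  have si: "square_integrable (\<lambda>x. rep_L2 f x - rep_L2 g x)"
    by (simp add: square_integrable_diff)
  have "(norm (f - g))\<^sup>2 = (LINT x|lebesgue. (cmod (rep_L2 f x - rep_L2 g x))\<^sup>2)"
    using norm_L2_of[OF si] by (simp add: L2_of_diff)
  with si show ?thesis
    by (simp add: square_integrable_def nn_integral_eq_integral)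
qed

lemma L2_Cauchy_convergent:
  fixes X :: "nat \<Rightarrow> 'a::euclidean_space L2"
  assumes "Cauchy X"
  shows "convergent X"
proof -
  have meas [measurable]: "rep_L2 f \<in> borel_measurable lebesgue" for f :: "'a L2"
    using square_integrable_rep[of f] by (simp add: square_integrable_def del: square_integrable_rep)
  have "\<exists>N. \<forall>m\<ge>N. \<forall>n\<ge>N. norm (X m - X n) < (1/4) ^ k" for k
    using assms by (auto simp: Cauchy_def dist_norm)
  then obtain N where N: "\<And>k m n. N k \<le> m \<Longrightarrow> N k \<le> n \<Longrightarrow> norm (X m - X n) < (1/4) ^ k"
    by metis
  define r where "r k = (\<Sum>j\<le>k. N j)" for k
  have rN: "N k \<le> r m" if "k \<le> m" for k m
    unfolding r_def using that by (intro member_le_sum) auto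
  define F where "F k = rep_L2 (X (r k))" for k
  have [measurable]: "F k \<in> borel_measurable lebesgue" for k
    by (simp add: F_def)
  define D where "D k x = (cmod (F (Suc k) x - F k x))\<^sup>2" for k x
  have "(\<integral>\<^sup>+x. (\<Sum>k. ennreal (4^k * D k x)) \<partial>lebesgue) = (\<Sum>k. \<integral>\<^sup>+x. ennreal (4^k * D k x) \<partial>lebesgue)"
    unfolding D_def by (intro nn_integral_suminf) measurable
  also have "\<dots> \<le> (\<Sum>k. ennreal ((1/4)^k))"
  proof (intro suminf_le)
    fix k
    have "(\<integral>\<^sup>+x. ennreal (4^k * D k x) \<partial>lebesgue) = ennreal (4^k) * (\<integral>\<^sup>+x. ennreal (D k x) \<partial>lebesgue)"
      unfolding D_def by (subst nn_integral_cmult[symmetric]) (auto simp: ennreal_mult'')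
    also have "\<dots> = ennreal (4^k * (norm (X (r (Suc k)) - X (r k)))\<^sup>2)"
      unfolding D_def F_def by (simp add: nn_integral_rep_diff ennreal_mult'')
    also have "\<dots> \<le> ennreal (4^k * ((1/4)^k)\<^sup>2)"
      using N[OF rN[of k "Suc k"] rN[of k k]]
      by (intro ennreal_leI mult_left_mono power_mono) auto
    also have "(4::real)^k * ((1/4)^k)\<^sup>2 = (1/4)^k"
      by (simp add: power2_eq_square power_divide)
    finally show "(\<integral>\<^sup>+x. ennreal (4^k * D k x) \<partial>lebesgue) \<le> ennreal ((1/4)^k)" .
  qed auto
  also have "\<dots> = ennreal (\<Sum>k. (1/4)^k)"
    by (intro suminf_ennreal2) (auto intro!: summable_geometric)
  also have "\<dots> < \<infinity>" by simp
  finally have "AE x in lebesgue. (\<Sum>k. ennreal (4^k * D k x)) \<noteq> \<infinity>"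
    by (intro nn_integral_PInf_AE) (auto simp: D_def)
  then have conv: "AE x in lebesgue. (\<lambda>k. F k x) \<longlonglongrightarrow> lim (\<lambda>k. F k x)"
  proof eventually_elim
    case (elim x)
    have sm: "summable (\<lambda>k. 4^k * D k x)"
      using elim by (intro summable_suminf_not_top) (auto simp: D_def)
    then have "(\<lambda>k. 4^k * D k x) \<longlonglongrightarrow> 0"
      by (rule summable_LIMSEQ_zero)
    then obtain C where C: "\<And>k. norm (4^k * D k x) \<le> C"
      using convergent_imp_Bseq[of "\<lambda>k. 4^k * D k x"] by (auto simp: convergent_def Bseq_def)
    have bd: "norm (F (Suc k) x - F k x) \<le> sqrt C * (1/2)^k" for k
    proof -
      have "(2^k * cmod (F (Suc k) x - F k x))\<^sup>2 \<le> C"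
        using C[of k] by (simp add: D_def power_mult_distrib flip: power_mult)
         (simp add: power_mult mult.commute[of k])
      then have "2^k * cmod (F (Suc k) x - F k x) \<le> sqrt C"
        by (rule real_le_rsqrt)
      then show ?thesis by (simp add: power_divide field_simps)
    qed
    have "summable (\<lambda>k. sqrt C * (1/2)^k)"
      by (intro summable_mult summable_geometric) simp
    then have "summable (\<lambda>k. F (Suc k) x - F k x)"
      by (rule summable_comparison_test'[where N = 0]) (rule bd)
    then have "convergent (\<lambda>n. \<Sum>k<n. F (Suc k) x - F k x)"
      by (simp only: summable_iff_convergent)
    then have "convergent (\<lambda>k. F k x - F 0 x)"
      using sum_lessThan_telescope[of "\<lambda>k. F k x"] by simp
    then have "convergent (\<lambda>k. F k x)"
      by (simp only: convergent_diff_const_right_iff)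
    then show ?case by (simp add: convergent_LIMSEQ_iff)
  qed
  define f where "f x = lim (\<lambda>k. F k x)" for x
  have fm [measurable]: "f \<in> borel_measurable lebesgue"
    unfolding f_def by measurable
  have key: "(\<integral>\<^sup>+x. ennreal ((cmod (f x - F k x))\<^sup>2) \<partial>lebesgue) \<le> ennreal (((1/4)^k)\<^sup>2)" for k
  proof -
    have "(\<integral>\<^sup>+x. ennreal ((cmod (f x - F k x))\<^sup>2) \<partial>lebesgue)
        = (\<integral>\<^sup>+x. liminf (\<lambda>m. ennreal ((cmod (F m x - F k x))\<^sup>2)) \<partial>lebesgue)"
    proof (intro nn_integral_cong_AE)
      show "AE x in lebesgue. ennreal ((cmod (f x - F k x))\<^sup>2)
          = liminf (\<lambda>m. ennreal ((cmod (F m x - F k x))\<^sup>2))"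
        using conv
      proof eventually_elim
        case (elim x)
        have "(\<lambda>m. ennreal ((cmod (F m x - F k x))\<^sup>2)) \<longlonglongrightarrow> ennreal ((cmod (f x - F k x))\<^sup>2)"
          unfolding f_def by (intro tendsto_intros elim)
        then show ?case by (intro lim_imp_Liminf[OF sequentially_bot, symmetric])
      qed
    qed
    also have "\<dots> \<le> liminf (\<lambda>m. \<integral>\<^sup>+x. ennreal ((cmod (F m x - F k x))\<^sup>2) \<partial>lebesgue)"
      by (intro nn_integral_liminf) measurable
    also have "\<dots> = liminf (\<lambda>m. ennreal ((norm (X (r m) - X (r k)))\<^sup>2))"
      by (simp add: F_def nn_integral_rep_diff)
    also have "\<dots> \<le> ennreal (((1/4)^k)\<^sup>2)"
    proof (rule Liminf_le)
      show "\<forall>\<^sub>F m in sequentially. ennreal ((norm (X (r m) - X (r k)))\<^sup>2) \<le> ennreal (((1/4)^k)\<^sup>2)"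
      proof (rule eventually_sequentiallyI[of k])
        fix m assume "k \<le> m"
        then show "ennreal ((norm (X (r m) - X (r k)))\<^sup>2) \<le> ennreal (((1/4)^k)\<^sup>2)"
          using N[OF rN[of k m] rN[of k k]] by (intro ennreal_leI power_mono) auto
      qed
    qed simp
    finally show ?thesis .
  qed
  have "square_integrable (\<lambda>x. f x - F 0 x)"
    unfolding square_integrable_def
    using le_less_trans[OF key[of 0]]
    by (auto simp: integrable_iff_bounded)
  then have "square_integrable (\<lambda>x. (f x - F 0 x) + F 0 x)"
    by (intro square_integrable_add) (auto simp: F_def)
  then have f: "square_integrable f" by simp
  have dk: "norm (L2_of f - X (r k)) \<le> (1/4)^k" for k
  proof -
    have si: "square_integrable (\<lambda>x. f x - F k x)"
      using f by (intro square_integrable_diff) (auto simp: F_def)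
    have "L2_of f - X (r k) = L2_of (\<lambda>x. f x - F k x)"
      using f by (simp add: L2_of_diff F_def)
    then have "ennreal ((norm (L2_of f - X (r k)))\<^sup>2) \<le> ennreal (((1/4)^k)\<^sup>2)"
      using key[of k] si by (simp add: norm_L2_of square_integrable_def nn_integral_eq_integral)
    then show ?thesis by (simp add: power_mono_iff)
  qed
  have "X \<longlonglongrightarrow> L2_of f"
  proof (rule metric_LIMSEQ_I)
    fix e :: real assume "e > 0"
    then obtain k where k: "(1/4)^k < e / 2"
      using real_arch_pow_inv[of "e/2" "1/4"] by auto
    have "dist (X m) (L2_of f) < e" if "m \<ge> N k" for m
    proof -
      have "dist (X m) (L2_of f) \<le> dist (X m) (X (r k)) + dist (L2_of f) (X (r k))"
        by (rule dist_triangle2)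
      also have "\<dots> < e / 2 + e / 2"
        using N[OF that rN[of k k]] dk[of k] k by (intro add_strict_mono) (auto simp: dist_norm)
      finally show ?thesis by simp
    qed
    then show "\<exists>no. \<forall>n\<ge>no. dist (X n) (L2_of f) < e" by blast
  qed
  then show ?thesis by (auto simp: convergent_def)
qed

instance L2 :: (euclidean_space) banach
  by standard (rule L2_Cauchy_convergent)



lemma separable_second_countable:
  fixes D :: "'b::metric_space set"
  assumes "countable D" and "closure D = UNIV"
  shows "\<exists>B::'b set set. countable B \<and> open = generate_topology B"
proof (intro exI conjI ext iffI)
  define B where "B = (\<lambda>(d, n). ball d (1 / real (Suc n))) ` (D \<times> (UNIV :: nat set))"
  show "countable B" unfolding B_def using assms by auto
  fix U :: "'b set"
  show "open U" if "generate_topology B U"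
    using that by induction (auto simp: B_def)
  assume "open U"
  have "\<exists>V\<in>B. x \<in> V \<and> V \<subseteq> U" if x: "x \<in> U" for x
  proof -
    obtain e where e: "e > 0" "ball x e \<subseteq> U" using \<open>open U\<close> x openE by blast
    obtain n where n: "1 / real (Suc n) < e / 2" 
      using nat_approx_posE[of "e/2"] e by auto
    have "x \<in> closure D" using assms by simp
    then obtain d where d: "d \<in> D" "dist d x < 1 / real (Suc n)"
      unfolding closure_approachable by (metis of_nat_0_less_iff zero_less_Suc zero_less_divide_1_iff)
    have "ball d (1 / real (Suc n)) \<subseteq> ball x e"
    proof
      fix y assume "y \<in> ball d (1 / real (Suc n))"
      then have "dist x y < e" 
        using d n dist_triangle[of x y d] by (simp add: dist_commute)
      then show "y \<in> ball x e" by simp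
    qed
    then show ?thesis
      using d e by (intro bexI[of _ "ball d (1 / real (Suc n))"]) (auto simp: B_def)
  qed
  then have "U = \<Union>{V \<in> B. V \<subseteq> U}" by blast
  moreover have "generate_topology B (\<Union>{V \<in> B. V \<subseteq> U})"
    by (intro generate_topology.UN) (auto intro: generate_topology.Basis)
  ultimately show "generate_topology B U" by simp
qed

definition L2_ind :: "complex \<Rightarrow> 'a::euclidean_space set \<Rightarrow> 'a L2" where
  "L2_ind c A = L2_of (\<lambda>x. c * indicator A x)"

lemma square_integrable_indicator:
  assumes "A \<in> lmeasurable"
  shows "square_integrable (\<lambda>x. c * indicator A x)"
proof -
  have "integrable lebesgue (\<lambda>x. (cmod (indicator A x :: complex))\<^sup>2)"
  proof -
    have "(\<lambda>x. (cmod (indicator A x :: complex))\<^sup>2) = (\<lambda>x. indicator A x :: real)"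
      by (auto simp: indicator_def)
    moreover have "integrable lebesgue (indicat_real A)"
      using assms by (intro integrable_real_indicator) (auto simp: fmeasurable_def)
    ultimately show ?thesis by simp
  qed
  moreover have "A \<in> sets lebesgue" using assms by (simp add: fmeasurable_def)
  ultimately have "square_integrable (\<lambda>x. indicator A x :: complex)"
    by (simp add: square_integrable_def)
  then show ?thesis by (rule square_integrable_scaleC)
qed

lemma norm_L2_ind_diff:
  assumes "A \<in> lmeasurable" "B \<in> lmeasurable" "A \<subseteq> B"
  shows "(norm (L2_ind c A - L2_ind c B))\<^sup>2 = (cmod c)\<^sup>2 * measure lebesgue (B - A)"
proof -
  note si = square_integrable_indicator[OF assms(1), of c] square_integrable_indicator[OF assms(2), of c]
  have "(norm (L2_ind c A - L2_ind c B))\<^sup>2 = (LINT x|lebesgue. (cmod (c * indicator A x - c * indicator B x))\<^sup>2)"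
    unfolding L2_ind_def using si by (simp add: L2_of_diff[symmetric] norm_L2_of square_integrable_diff)
  also have "\<dots> = (LINT x|lebesgue. (cmod c)\<^sup>2 * indicator (B - A) x)"
    using assms(3) by (intro Bochner_Integration.integral_cong) (auto simp: indicator_def)
  also have "\<dots> = (cmod c)\<^sup>2 * measure lebesgue (B - A)"
    by simp
  finally show ?thesis .
qed

lemma norm_L2_ind_diff2:
  assumes "A \<in> lmeasurable"
  shows "norm (L2_ind c A - L2_ind d A) = cmod (c - d) * sqrt (measure lebesgue A)"
proof -
  note si = square_integrable_indicator[OF assms, of c] square_integrable_indicator[OF assms, of d]
  have "(norm (L2_ind c A - L2_ind d A))\<^sup>2 = (LINT x|lebesgue. (cmod (c * indicator A x - d * indicator A x))\<^sup>2)"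
    unfolding L2_ind_def using si by (simp add: L2_of_diff[symmetric] norm_L2_of square_integrable_diff)
  also have "\<dots> = (LINT x|lebesgue. (cmod (c - d))\<^sup>2 * indicator A x)"
    by (intro Bochner_Integration.integral_cong) (auto simp: indicator_def)
  also have "\<dots> = (cmod (c - d))\<^sup>2 * measure lebesgue A"
    by simp
  also have "\<dots> = (cmod (c - d) * sqrt (measure lebesgue A))\<^sup>2"
    by (simp add: power_mult_distrib)
  finally show ?thesis by (simp add: power2_eq_iff_nonneg)
qed

lemma L2_of_sum:
  assumes "finite I" "\<And>i. i \<in> I \<Longrightarrow> square_integrable (f i)"
  shows "square_integrable (\<lambda>x. \<Sum>i\<in>I. f i x) \<and> L2_of (\<lambda>x. \<Sum>i\<in>I. f i x) = (\<Sum>i\<in>I. L2_of (f i))"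
  using assms
proof (induction I rule: finite_induct)
  case empty
  then show ?case by (simp add: square_integrable_zero)
next
  case (insert i I)
  then have "square_integrable (f i)" "square_integrable (\<lambda>x. \<Sum>i\<in>I. f i x)"
    "L2_of (\<lambda>x. \<Sum>i\<in>I. f i x) = (\<Sum>i\<in>I. L2_of (f i))" by simp_all
  then show ?case
    using insert.hyps L2_of_add[of "f i" "\<lambda>x. \<Sum>i\<in>I. f i x"]
      square_integrable_add[of "f i" "\<lambda>x. \<Sum>i\<in>I. f i x"] by simp
qed

lemma L2_separable: "\<exists>D::'a::euclidean_space L2 set. countable D \<and> closure D = UNIV"
proof -
  obtain Q :: "complex set" where Q: "countable Q"
    "\<And>X. open X \<Longrightarrow> X \<noteq> {} \<Longrightarrow> \<exists>d\<in>Q. d \<in> X"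
    by (erule countable_dense_setE)
  obtain B :: "'a set set" where B: "countable B" "\<And>C. C \<in> B \<Longrightarrow> open C"
    "\<And>S. open S \<Longrightarrow> \<exists>U. U \<subseteq> B \<and> S = \<Union>U"
    using univ_second_countable by metis
  define K where "K = (\<lambda>(X, n::nat). X \<inter> ball 0 (real n)) ` (B \<times> UNIV)"
  define E where "E = Union ` {F. finite F \<and> F \<subseteq> K}"
  have "countable K" unfolding K_def using B by auto
  then have "countable E" unfolding E_def
    by (intro countable_image countable_Collect_finite_subset)
  have El: "S \<in> lmeasurable" if S: "S \<in> E" for S
  proof -
    obtain F where F: "finite F" "F \<subseteq> K" "S = \<Union>F" using S by (auto simp: E_def)
    have "X \<in> lmeasurable" if X: "X \<in> F" for X
    proof -
      obtain Y n where "Y \<in> B" "X = Y \<inter> ball 0 (real n)"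
        using subsetD[OF F(2) X] unfolding K_def by auto
      then have "open X" "bounded X" using B(2) by (auto intro: bounded_subset[OF bounded_ball])
      then show ?thesis by (rule lmeasurable_open[rotated])
    qed
    then show ?thesis unfolding F(3) using F(1) by (intro fmeasurable.finite_Union) auto
  qed
  define D where "D = (\<lambda>l. sum_list (map (\<lambda>(q, S). L2_ind q S) l)) ` lists (Q \<times> E)"
  have "countable D" unfolding D_def using Q \<open>countable E\<close> by auto
  have D0: "0 \<in> D" unfolding D_def by (rule image_eqI[of _ _ "[]"]) auto
  have Dadd: "u + v \<in> D" if uv: "u \<in> D" "v \<in> D" for u v
  proof -
    obtain k l where "k \<in> lists (Q \<times> E)" "l \<in> lists (Q \<times> E)"
      "u = sum_list (map (\<lambda>(q, S). L2_ind q S) k)" "v = sum_list (map (\<lambda>(q, S). L2_ind q S) l)"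
      using uv by (auto simp: D_def)
    then show ?thesis unfolding D_def by (intro image_eqI[of _ _ "k @ l"]) auto
  qed
  have Dind: "L2_ind q S \<in> D" if "q \<in> Q" "S \<in> E" for q S
    unfolding D_def using that by (intro image_eqI[of _ _ "[(q, S)]"]) auto
  have V0: "0 \<in> closure D" using D0 closure_subset by blast
  have Vadd: "u + v \<in> closure D" if uv: "u \<in> closure D" "v \<in> closure D" for u v
  proof -
    obtain a b where "\<And>n. a n \<in> D" "a \<longlonglongrightarrow> u" "\<And>n. b n \<in> D" "b \<longlonglongrightarrow> v"
      using uv unfolding closure_sequential by auto
    then show ?thesis unfolding closure_sequential
      by (intro exI[of _ "\<lambda>n. a n + b n"]) (auto intro: Dadd tendsto_add)
  qed
  have Vcl: "u \<in> closure D" if "\<And>e. e > 0 \<Longrightarrow> \<exists>v\<in>closure D. norm (v - u) < e" for u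
    using that closure_approachable[of u "closure D"] by (auto simp: dist_norm)
  have Vlim: "l \<in> closure D" if "\<And>n. x n \<in> closure D" "x \<longlonglongrightarrow> l" for x and l :: "'a L2"
    using closed_closure[of D] that unfolding closed_sequential_limits by metis
  have V1: "L2_ind c S \<in> closure D" if "S \<in> E" for c S
  proof (rule Vcl)
    fix e :: real assume "e > 0"
    define d where "d = e / (sqrt (measure lebesgue S) + 1)"
    have pos: "sqrt (measure lebesgue S) + 1 > 0" by (simp add: add_nonneg_pos)
    have "d > 0" unfolding d_def using \<open>e > 0\<close> pos by simp
    then obtain q where q: "q \<in> Q" "q \<in> ball c d" using Q(2)[of "ball c d"] by auto
    have "norm (L2_ind q S - L2_ind c S) = cmod (q - c) * sqrt (measure lebesgue S)"
      using norm_L2_ind_diff2[OF El[OF that]] by simp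
    also have "\<dots> \<le> d * sqrt (measure lebesgue S)"
      using q by (intro mult_right_mono) (auto simp: dist_norm norm_minus_commute)
    also have "\<dots> < d * (sqrt (measure lebesgue S) + 1)"
      using \<open>d > 0\<close> by simp
    also have "\<dots> = e" unfolding d_def using pos by simp
    finally show "\<exists>v\<in>closure D. norm (v - L2_ind c S) < e"
      using Dind[OF q(1) that] closure_subset by blast
  qed
  have V2: "L2_ind c U \<in> closure D" if U: "open U" "U \<in> lmeasurable" for c U
  proof -
    define L where "L = {X \<in> K. X \<subseteq> U}"
    have "countable L" unfolding L_def using \<open>countable K\<close> by auto
    have "\<Union>L = U"
    proof
      show "U \<subseteq> \<Union>L"
      proof
        fix x assume x: "x \<in> U"
        obtain W where W: "W \<subseteq> B" "U = \<Union>W" using B(3)[OF U(1)] by blast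
        then obtain X where X: "X \<in> W" "x \<in> X" using x by auto
        obtain n :: nat where "norm x < real n" using reals_Archimedean2 by blast
        then have "x \<in> X \<inter> ball 0 (real n)" using X by simp
        moreover have "X \<inter> ball 0 (real n) \<in> L"
          unfolding L_def K_def using X W by auto
        ultimately show "x \<in> \<Union>L" by blast
      qed
    qed (auto simp: L_def)
    have "L \<noteq> {}"
    proof -
      obtain W' where W': "W' \<subseteq> B" "UNIV = \<Union>W'" using B(3)[of UNIV] by auto
      then have "B \<noteq> {}" by auto
      then obtain X where "X \<in> B" by auto
      then have "X \<inter> ball 0 (real 0) \<in> K" unfolding K_def by (intro image_eqI[of _ _ "(X, 0)"]) auto
      then show ?thesis unfolding L_def by auto
    qed
    define g where "g = from_nat_into L"
    have g: "range g = L" unfolding g_def using \<open>L \<noteq> {}\<close> \<open>countable L\<close> by (rule range_from_nat_into)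
    define S where "S n = (\<Union>i\<le>n. g i)" for n :: nat
    have SE: "S n \<in> E" for n
      unfolding E_def S_def using g by (auto simp: L_def intro!: image_eqI[of _ _ "g ` {..n}"])
    have SU: "S n \<subseteq> U" for n unfolding S_def using g \<open>\<Union>L = U\<close> by auto
    have UU: "(\<Union>n. S n) = U" unfolding S_def using g \<open>\<Union>L = U\<close> by auto
    have incS: "incseq S" unfolding S_def incseq_def by (auto intro: order_trans)
    have "(\<lambda>n. measure lebesgue (S n)) \<longlonglongrightarrow> measure lebesgue (\<Union>n. S n)"
    proof (rule Lim_measure_incseq)
      show "range S \<subseteq> sets lebesgue" using SE El by (auto simp: fmeasurable_def)
      show "emeasure lebesgue (\<Union>n. S n) \<noteq> \<infinity>" unfolding UU infinity_ennreal_def using fmeasurableD2[OF U(2)] .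
    qed fact
    then have lim: "(\<lambda>n. measure lebesgue (S n)) \<longlonglongrightarrow> measure lebesgue U" by (simp add: UU)
    have eq: "norm (L2_ind c (S n) - L2_ind c U)
        = sqrt ((cmod c)\<^sup>2 * (measure lebesgue U - measure lebesgue (S n)))" for n
    proof -
      have "measure lebesgue (U - S n) = measure lebesgue U - measure lebesgue (S n)"
        using SU[of n] El[OF SE[of n]] U(2) by (intro measurable_measure_Diff) (auto simp: fmeasurable_def)
      then show ?thesis
        using norm_L2_ind_diff[OF El[OF SE[of n]] U(2) SU, of c] by (metis norm_ge_zero real_sqrt_unique)
    qed
    have "(\<lambda>n. norm (L2_ind c (S n) - L2_ind c U))
        \<longlonglongrightarrow> sqrt ((cmod c)\<^sup>2 * (measure lebesgue U - measure lebesgue U))"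
      unfolding eq by (intro tendsto_intros lim)
    then have "(\<lambda>n. L2_ind c (S n)) \<longlonglongrightarrow> L2_ind c U"
      by (simp add: tendsto_norm_zero_iff LIM_zero_iff)
    then show ?thesis
      by (rule Vlim[OF V1[OF SE]])
  qed
  have V3: "L2_ind c A \<in> closure D" if A: "A \<in> lmeasurable" for c A
  proof (rule Vcl)
    fix e :: real assume "e > 0"
    define d where "d = e\<^sup>2 / ((cmod c)\<^sup>2 + 1)"
    have pos: "(cmod c)\<^sup>2 + 1 > 0" by (simp add: add_nonneg_pos)
    have "d > 0" unfolding d_def using \<open>e > 0\<close> pos by simp
    obtain T where T: "open T" "A \<subseteq> T" "T - A \<in> lmeasurable" "emeasure lebesgue (T - A) < ennreal d"
      using sets_lebesgue_outer_open[of A d] A \<open>d > 0\<close> by (auto simp: fmeasurable_def)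
    have "T = A \<union> (T - A)" using T by auto
    then have Tl: "T \<in> lmeasurable" using A T(3) by (metis fmeasurable.Un)
    have "measure lebesgue (T - A) < d"
      using T(3,4) \<open>d > 0\<close> by (simp add: emeasure_eq_measure2 ennreal_less_iff)
    have "(norm (L2_ind c T - L2_ind c A))\<^sup>2 = (cmod c)\<^sup>2 * measure lebesgue (T - A)"
      using norm_L2_ind_diff[OF A Tl T(2), of c] by (simp add: norm_minus_commute)
    also have "\<dots> \<le> (cmod c)\<^sup>2 * d"
      using \<open>measure lebesgue (T - A) < d\<close> by (intro mult_left_mono) auto
    also have "\<dots> < ((cmod c)\<^sup>2 + 1) * d" using \<open>d > 0\<close> by simp
    also have "\<dots> = e\<^sup>2" unfolding d_def using pos by simp
    finally have "norm (L2_ind c T - L2_ind c A) < e"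
      using \<open>e > 0\<close> power_less_imp_less_base[of _ 2 e] by (metis less_imp_le)
    then show "\<exists>v\<in>closure D. norm (v - L2_ind c A) < e"
      using V2[OF T(1) Tl] by blast
  qed
  have V4: "L2_of s \<in> closure D" if s: "simple_function lebesgue s" "square_integrable s" for s
  proof -
    define A where "A y = s -` {y} \<inter> space lebesgue" for y
    have fin: "finite (range s)" using s(1) by (simp add: simple_function_def)
    have Al: "A y \<in> lmeasurable" if "y \<noteq> 0" for y
    proof -
      have Am: "A y \<in> sets lebesgue"
        using s(1) unfolding A_def by (rule simple_functionD(2))
      have "emeasure lebesgue (A y) = (\<integral>\<^sup>+x. indicator (A y) x \<partial>lebesgue)" using Am by simp
      also have "\<dots> \<le> (\<integral>\<^sup>+x. ennreal ((1 / (cmod y)\<^sup>2) * (cmod (s x))\<^sup>2) \<partial>lebesgue)"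
        using that by (intro nn_integral_mono) (auto simp: A_def indicator_def)
      also have "\<dots> < \<infinity>"
      proof -
        have "integrable lebesgue (\<lambda>x. (1 / (cmod y)\<^sup>2) * (cmod (s x))\<^sup>2)"
          using s(2) by (simp add: square_integrable_def)
        then show ?thesis by (subst nn_integral_eq_integral) auto
      qed
      finally show ?thesis using Am by (simp add: fmeasurable_def)
    qed
    have "s x = (\<Sum>y\<in>range s - {0}. y * indicator (A y) x)" for x
    proof (cases "s x = 0")
      case True
      then show ?thesis by (simp add: A_def indicator_def)
    next
      case False
      have "(\<Sum>y\<in>range s - {0}. y * indicator (A y) x) = (\<Sum>y\<in>range s - {0}. if y = s x then y else 0)"
        by (intro sum.cong) (auto simp: A_def indicator_def)
      also have "\<dots> = s x" using fin False by (subst sum.delta) auto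
      finally show ?thesis by simp
    qed
    then have "s = (\<lambda>x. \<Sum>y\<in>range s - {0}. y * indicator (A y) x)" by blast
    then have "L2_of s = (\<Sum>y\<in>range s - {0}. L2_ind y (A y))"
      unfolding L2_ind_def
      using L2_of_sum[of "range s - {0}" "\<lambda>y x. y * indicator (A y) x"] fin
        square_integrable_indicator[OF Al] by simp
    moreover have "(\<Sum>y\<in>I. L2_ind y (A y)) \<in> closure D" if "finite I" "0 \<notin> I" for I
      using that by (induction I rule: finite_induct) (auto intro!: V0 Vadd V3 Al)
    ultimately show ?thesis using fin by simp
  qed
  have "f \<in> closure D" for f
  proof -
    define h where "h = rep_L2 f"
    have h: "square_integrable h" by (simp add: h_def)
    then have hm [measurable]: "h \<in> borel_measurable lebesgue" by (simp add: square_integrable_def)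
    obtain s where s: "\<And>i. simple_function lebesgue (s i)"
      "\<And>x. (\<lambda>i. s i x) \<longlonglongrightarrow> h x" "\<And>i x. cmod (s i x) \<le> 2 * cmod (h x)"
      using borel_measurable_implies_sequence_metric[OF hm, of 0] by auto
    have sm [measurable]: "s i \<in> borel_measurable lebesgue" for i
      using s(1) by (rule borel_measurable_simple_function)
    have hi: "integrable lebesgue (\<lambda>x. 9 * (cmod (h x))\<^sup>2)"
      using h by (simp add: square_integrable_def)
    have bnd: "(cmod (s i x - h x))\<^sup>2 \<le> 9 * (cmod (h x))\<^sup>2" for i x
    proof -
      have "cmod (s i x - h x) \<le> 3 * cmod (h x)"
        using s(3)[of i x] norm_triangle_ineq4[of "s i x" "h x"] by simp
      then have "(cmod (s i x - h x))\<^sup>2 \<le> (3 * cmod (h x))\<^sup>2" by (intro power_mono) auto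
      then show ?thesis by (simp add: power_mult_distrib)
    qed
    have sd: "square_integrable (\<lambda>x. s i x - h x)" for i
      unfolding square_integrable_def
      using hi by (auto intro!: Bochner_Integration.integrable_bound[OF hi] bnd)
    then have si: "square_integrable (s i)" for i
      using square_integrable_add[OF sd[of i] h] by simp
    have "(\<lambda>i. LINT x|lebesgue. (cmod (s i x - h x))\<^sup>2) \<longlonglongrightarrow> integral\<^sup>L lebesgue (\<lambda>x::'a. 0 :: real)"
    proof (rule integral_dominated_convergence[where w = "\<lambda>x. 9 * (cmod (h x))\<^sup>2"])
      show "AE x in lebesgue. (\<lambda>i. (cmod (s i x - h x))\<^sup>2) \<longlonglongrightarrow> 0"
      proof (rule AE_I2)
        fix x
        have "(\<lambda>i. (cmod (s i x - h x))\<^sup>2) \<longlonglongrightarrow> (cmod (h x - h x))\<^sup>2"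
          by (intro tendsto_intros s(2))
        then show "(\<lambda>i. (cmod (s i x - h x))\<^sup>2) \<longlonglongrightarrow> 0" by simp
      qed
    qed (use bnd hi in auto)
    moreover have "(LINT x|lebesgue. (cmod (s i x - h x))\<^sup>2) = (norm (L2_of (s i) - f))\<^sup>2" for i
      using norm_L2_of[OF sd[of i]] L2_of_diff[OF si[of i] h] by (simp add: h_def)
    ultimately have "(\<lambda>i. (norm (L2_of (s i) - f))\<^sup>2) \<longlonglongrightarrow> 0" by simp
    then have "(\<lambda>i. sqrt ((norm (L2_of (s i) - f))\<^sup>2)) \<longlonglongrightarrow> sqrt 0"
      by (intro tendsto_intros)
    then have "(\<lambda>i. L2_of (s i)) \<longlonglongrightarrow> f"
      by (simp add: tendsto_norm_zero_iff LIM_zero_iff)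
    then show ?thesis
      by (rule Vlim[OF V4[OF s(1) si]])
  qed
  then show ?thesis using \<open>countable D\<close> by blast
qed

instance L2 :: (euclidean_space) second_countable_topology
proof
  obtain D :: "'a L2 set" where "countable D" "closure D = UNIV"
    using L2_separable by blast
  then show "\<exists>B::'a L2 set set. countable B \<and> open = generate_topology B"
    by (rule separable_second_countable)
qed


definition scaleC_L2 :: "complex \<Rightarrow> 'a::euclidean_space L2 \<Rightarrow> 'a L2" where
  "scaleC_L2 c f = L2_of (\<lambda>x. c * rep_L2 f x)"

definition L2_on :: "'a::euclidean_space set \<Rightarrow> 'a L2 set" where
  "L2_on A = {f. AE x in lebesgue. x \<notin> A \<longrightarrow> rep_L2 f x = 0}"

definition restrict_L2 :: "'a::euclidean_space set \<Rightarrow> 'a L2 \<Rightarrow> 'a L2" where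
  "restrict_L2 A f = L2_of (\<lambda>x. indicator A x * rep_L2 f x)"

text \<open>The slice \<open>u(s, \<cdot>)\<close> of a class in space-time. By Fubini it is square integrable for almost
  every \<open>s\<close>, and up to a null set of times it does not depend on the chosen representative.\<close>

definition time_slice :: "(real \<times> 'a::euclidean_space) L2 \<Rightarrow> real \<Rightarrow> 'a L2" where
  "time_slice u s = L2_of (\<lambda>x. rep_L2 u (s, x))"


section \<open>Bounded Lipschitz domains\<close>

text \<open>Near each boundary point the domain is, for a suitable unit vector \<open>\<nu>\<close>, the strict epigraph
  (in direction \<open>\<nu>\<close>) of a Lipschitz function on the hyperplane orthogonal to \<open>\<nu>\<close>.\<close>

definition lipschitz_domain :: "'a::euclidean_space set \<Rightarrow> bool" where
  "lipschitz_domain G \<longleftrightarrow>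
     open G \<and> connected G \<and> G \<noteq> {} \<and>
     (\<forall>p\<in>frontier G. \<exists>r>0. \<exists>\<nu> L. \<exists>\<gamma> :: 'a \<Rightarrow> real.
        norm \<nu> = 1 \<and> L-lipschitz_on {z. z \<bullet> \<nu> = 0} \<gamma> \<and>
        (\<forall>x\<in>ball p r. x \<in> G \<longleftrightarrow> \<gamma> (x - (x \<bullet> \<nu>) *\<^sub>R \<nu>) < x \<bullet> \<nu>))"


section \<open>The Dirichlet Laplacian\<close>

definition dir_deriv :: "'a::euclidean_space \<Rightarrow> ('a \<Rightarrow> complex) \<Rightarrow> 'a \<Rightarrow> complex" where
  "dir_deriv b \<phi> x = frechet_derivative \<phi> (at x) b"

primrec C_k :: "nat \<Rightarrow> ('a::euclidean_space \<Rightarrow> complex) \<Rightarrow> bool" where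
  "C_k 0 \<phi> \<longleftrightarrow> continuous_on UNIV \<phi>"
| "C_k (Suc k) \<phi> \<longleftrightarrow> (\<forall>x. \<phi> differentiable (at x)) \<and> (\<forall>b\<in>Basis. C_k k (dir_deriv b \<phi>))"

definition test_function :: "'a::euclidean_space set \<Rightarrow> ('a \<Rightarrow> complex) \<Rightarrow> bool" where
  "test_function G \<phi> \<longleftrightarrow>
     (\<forall>k. C_k k \<phi>) \<and> compact (closure {x. \<phi> x \<noteq> 0}) \<and> closure {x. \<phi> x \<noteq> 0} \<subseteq> G"

definition laplace :: "('a::euclidean_space \<Rightarrow> complex) \<Rightarrow> 'a \<Rightarrow> complex" where
  "laplace \<phi> x = (\<Sum>b\<in>Basis. dir_deriv b (dir_deriv b \<phi>) x)"

definition weak_deriv :: "'a::euclidean_space set \<Rightarrow> 'a \<Rightarrow> 'a L2 \<Rightarrow> 'a L2 \<Rightarrow> bool" where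
  "weak_deriv G b f g \<longleftrightarrow>
     (\<forall>\<phi>. test_function G \<phi> \<longrightarrow>
        (LINT x|lebesgue. rep_L2 f x * dir_deriv b \<phi> x) = - (LINT x|lebesgue. rep_L2 g x * \<phi> x))"

text \<open>\<open>H\<^sub>0\<^sup>1(G)\<close>: the closure of the test functions in the norm of \<open>H\<^sup>1(G)\<close>; \<open>g b\<close> is the weak
  partial derivative of \<open>f\<close> in direction \<open>b\<close>.\<close>

definition H10 :: "'a::euclidean_space set \<Rightarrow> 'a L2 set" where
  "H10 G = {f \<in> L2_on G. \<exists>g.
     (\<forall>b\<in>Basis. g b \<in> L2_on G \<and> weak_deriv G b f (g b)) \<and>
     (\<forall>\<epsilon>>0. \<exists>\<phi>. test_function G \<phi> \<and>
        sqrt ((norm (f - L2_of \<phi>))\<^sup>2 + (\<Sum>b\<in>Basis. (norm (g b - L2_of (dir_deriv b \<phi>)))\<^sup>2)) < \<epsilon>)}"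

text \<open>The graph of the Dirichlet Laplacian, whose domain consists of the \<open>f\<close> in \<open>H\<^sub>0\<^sup>1(G)\<close> with
  distributional Laplacian \<open>h\<close> in \<open>L\<^sup>2(G)\<close>.\<close>

definition dirichlet_laplacian :: "'a::euclidean_space set \<Rightarrow> 'a L2 \<Rightarrow> 'a L2 \<Rightarrow> bool" where
  "dirichlet_laplacian G f h \<longleftrightarrow>
     f \<in> H10 G \<and> h \<in> L2_on G \<and>
     (\<forall>\<phi>. test_function G \<phi> \<longrightarrow>
        (LINT x|lebesgue. rep_L2 f x * laplace \<phi> x) = (LINT x|lebesgue. rep_L2 h x * \<phi> x))"


section \<open>The unitary group generated by \<open>\<i>\<Delta>\<close>\<close>

definition unitary_group_on :: "'a::euclidean_space L2 set \<Rightarrow> (real \<Rightarrow> 'a L2 \<Rightarrow> 'a L2) \<Rightarrow> bool" where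
  "unitary_group_on H S \<longleftrightarrow>
     (\<forall>t. bij_betw (S t) H H \<and>
          (\<forall>f\<in>H. \<forall>g\<in>H. S t (f + g) = S t f + S t g) \<and>
          (\<forall>c. \<forall>f\<in>H. S t (scaleC_L2 c f) = scaleC_L2 c (S t f)) \<and>
          (\<forall>f\<in>H. norm (S t f) = norm f)) \<and>
     (\<forall>f\<in>H. S 0 f = f) \<and>
     (\<forall>s t. \<forall>f\<in>H. S (s + t) f = S s (S t f)) \<and>
     (\<forall>f\<in>H. continuous_on UNIV (\<lambda>t. S t f))"

definition group_generator ::
    "'a::euclidean_space L2 set \<Rightarrow> (real \<Rightarrow> 'a L2 \<Rightarrow> 'a L2) \<Rightarrow> 'a L2 \<Rightarrow> 'a L2 \<Rightarrow> bool" where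
  "group_generator H S f g \<longleftrightarrow>
     f \<in> H \<and> g \<in> H \<and> ((\<lambda>h. (1 / h) *\<^sub>R (S h f - f)) \<longlongrightarrow> g) (at 0)"

text \<open>\<open>S t\<close> is \<open>e\<^sup>i\<^sup>t\<^sup>\<Delta>\<close> on \<open>L\<^sup>2(G)\<close>. The group is determined by its generator, hence \<open>S t f\<close> is
  uniquely determined for \<open>f\<close> in \<open>L2_on G\<close>; its values elsewhere are irrelevant.\<close>

definition schroedinger_group :: "'a::euclidean_space set \<Rightarrow> (real \<Rightarrow> 'a L2 \<Rightarrow> 'a L2) \<Rightarrow> bool" where
  "schroedinger_group G S \<longleftrightarrow>
     unitary_group_on (L2_on G) S \<and>
     (\<forall>f g. group_generator (L2_on G) S f g \<longleftrightarrow>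
            (\<exists>h. dirichlet_laplacian G f h \<and> g = scaleC_L2 \<i> h))"


section \<open>The random Schroedinger system and its control\<close>

definition absolutely_continuous_rv :: "'w measure \<Rightarrow> ('w \<Rightarrow> real) \<Rightarrow> bool" where
  "absolutely_continuous_rv M \<alpha> \<longleftrightarrow>
     (\<exists>\<rho>. integrable lborel \<rho> \<and> (\<forall>x. 0 \<le> \<rho> x) \<and> distributed M lborel \<alpha> (\<lambda>x. ennreal (\<rho> x)))"

text \<open>The solution at time \<open>t\<close> with \<open>\<alpha>\<close> replaced by \<open>\<xi>\<close>, initial state \<open>y0\<close> and control \<open>u\<close>
  (\<open>S\<close> being the group generated by \<open>\<i>\<Delta>\<close>).\<close>

definition solution :: "(real \<Rightarrow> 'a::euclidean_space L2 \<Rightarrow> 'a L2) \<Rightarrow> 'a set \<Rightarrow>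
    real \<Rightarrow> real \<Rightarrow> 'a L2 \<Rightarrow> (real \<times> 'a) L2 \<Rightarrow> 'a L2" where
  "solution S G0 t \<xi> y0 u =
     S (t * \<xi>) y0 +
     (LINT s|lebesgue_on {0..t}. S ((t - s) * \<xi>) (restrict_L2 G0 (time_slice u s)))"

definition average_solution :: "'w measure \<Rightarrow> ('w \<Rightarrow> real) \<Rightarrow>
    (real \<Rightarrow> 'a::euclidean_space L2 \<Rightarrow> 'a L2) \<Rightarrow> 'a set \<Rightarrow>
    real \<Rightarrow> 'a L2 \<Rightarrow> (real \<times> 'a) L2 \<Rightarrow> 'a L2" where
  "average_solution M \<alpha> S G0 t y0 u = (LINT \<omega>|M. solution S G0 t (\<alpha> \<omega>) y0 u)"

definition exactly_controllable_in_average :: "'w measure \<Rightarrow> ('w \<Rightarrow> real) \<Rightarrow>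
    (real \<Rightarrow> 'a::euclidean_space L2 \<Rightarrow> 'a L2) \<Rightarrow> 'a set \<Rightarrow> 'a set \<Rightarrow> real \<Rightarrow> bool" where
  "exactly_controllable_in_average M \<alpha> S G G0 T \<longleftrightarrow>
     (\<exists>C>0. \<forall>y0\<in>L2_on G. \<forall>y1\<in>L2_on G. \<exists>u\<in>L2_on ({0<..<T} \<times> G0).
        norm u \<le> C * (norm y0 + norm y1) \<and> average_solution M \<alpha> S G0 T y0 u = y1)"

end

theory Submission
  imports Defs
begin

text \<open>Exact controllability in average is a quantitative surjectivity: for zero initial state
  every target \<open>y1\<close> is reached with a control of norm at most \<open>C * norm y1\<close>. By duality this
  is an observability inequality. If \<open>U t\<close> is the unitary group \<open>exp (\<i> t \<Delta>)\<close> and \<open>E\<close> the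
  expectation, then a control \<open>u\<close> which steers \<open>0\<close> to \<open>\<phi>\<close> satisfies
  \<open>(norm \<phi>)^2 = (integral over s from 0 to T of v s \<bullet> E (U ((s - T) * \<alpha>) \<phi>))\<close>, where \<open>v s\<close> is
  the control at time \<open>s\<close>, extended by zero. So a unit vector \<open>\<phi>\<close> can only be reached at cost
  \<open>C\<close> if \<open>1 \<le> C^2 * I \<phi>\<close>, where \<open>I \<phi>\<close> is the integral over \<open>s\<close> from \<open>0\<close> to \<open>T\<close> of the squared
  norm of \<open>E (U ((s - T) * \<alpha>) \<phi>)\<close> (lemma \<open>averaged_duality_bound\<close>). It remains to find unit
  vectors along which \<open>I\<close> tends to \<open>0\<close>.

  Averaging over a random speed destroys high frequencies. In place of eigenfunctions and the
  Riemann-Lebesgue lemma, the proof takes unit vectors \<open>\<phi>\<close> of the form \<open>\<i> \<Delta> \<psi>\<close> with \<open>\<psi>\<close> small.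
  Expanding the square with an independent copy of \<open>\<alpha>\<close>, \<open>I \<phi>\<close> is the expectation, over two
  independent values \<open>a\<close> and \<open>a'\<close>, of the integral over \<open>s\<close> of \<open>U ((s - T) * (a - a')) \<phi> \<bullet> \<phi>\<close>.
  Since \<open>\<phi>\<close> is the image of \<open>\<psi>\<close> under the generator, the integrand is the derivative of
  \<open>U ((s - T) * (a - a')) \<psi> \<bullet> \<phi> / (a - a')\<close>, and the integral is at most
  \<open>2 * norm \<psi> / \<bar>a - a'\<bar>\<close>. The law of \<open>\<alpha>\<close> has no atoms, so \<open>a\<close> and \<open>a'\<close> differ almost surely,
  and dominated convergence gives the claim (lemma \<open>averaged_orbits_vanish\<close>).

  Such \<open>\<psi>\<close> exist because the Laplacian is unbounded on test functions: multiplying a nonzero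
  test function by the plane wave \<open>exp (\<i> k (x \<bullet> b))\<close> preserves its norm, and the norm of the
  Laplacian grows like \<open>k^2\<close> (lemma \<open>laplace_unbounded\<close>). That there is a nonzero test
  function at all follows from the group itself: the domain of the generator of a strongly
  continuous group on a nonzero space is not zero, and by definition of \<open>H10\<close> its elements are
  limits of test functions (lemma \<open>exists_nonzero_test_function\<close>).\<close>

section \<open>Groups of isometries of a Hilbert space\<close>

lemma has_vector_derivative_quotient:
  assumes "(f has_vector_derivative v) (at 0)"
  shows "((\<lambda>h. (1 / h) *\<^sub>R (f h - f 0)) \<longlongrightarrow> v) (at 0)"
proof -
  have "((\<lambda>h. norm (f h - f 0 - h *\<^sub>R v) / norm h) \<longlongrightarrow> 0) (at 0)"
    using assms unfolding has_vector_derivative_def has_derivative_at by simp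
  moreover have "\<forall>\<^sub>F h in at 0. norm (f h - f 0 - h *\<^sub>R v) / norm h = norm ((1 / h) *\<^sub>R (f h - f 0) - v)"
    using eventually_neq_at_within[of 0 "0::real" UNIV]
  proof eventually_elim
    fix h :: real assume "h \<noteq> 0"
    then have "(1 / h) *\<^sub>R (f h - f 0) - v = (1 / h) *\<^sub>R (f h - f 0 - h *\<^sub>R v)"
      by (simp add: scaleR_diff_right)
    then show "norm (f h - f 0 - h *\<^sub>R v) / norm h = norm ((1 / h) *\<^sub>R (f h - f 0) - v)"
      by (simp only: norm_scaleR) (simp add: divide_inverse mult.commute)
  qed
  ultimately have "((\<lambda>h. norm ((1 / h) *\<^sub>R (f h - f 0) - v)) \<longlongrightarrow> 0) (at 0)"
    by (rule Lim_transform_eventually)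
  then show ?thesis by (simp add: tendsto_norm_zero_iff LIM_zero_iff)
qed

text \<open>The abstract part of the argument takes place in a real Hilbert space. It uses of a unitary
  group only that it is a strongly continuous group of real-linear isometries.\<close>

locale isometry_group =
  fixes U :: "real \<Rightarrow> 'h::{real_inner, banach, second_countable_topology} \<Rightarrow> 'h"
  assumes linear: "linear (U t)"
    and zero: "U 0 f = f"
    and add: "U (s + t) f = U s (U t f)"
    and norm: "norm (U t f) = norm f"
    and cont: "continuous_on UNIV (\<lambda>t. U t f)"
begin

lemma bounded_linear: "bounded_linear (U t)"
  using linear[of t] norm[of t]
  by (intro bounded_linear_intro[where K = 1]) (auto simp: linear_add linear_scale)

lemma diff: "U t (f - g) = U t f - U t g"
  using linear by (rule linear_diff)

lemma inner: "U t f \<bullet> U t g = f \<bullet> g"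
  by (simp add: dot_norm norm linear_add[OF linear, symmetric])

lemma adjoint: "U t f \<bullet> g = f \<bullet> U (- t) g"
  using inner[of t f "U (- t) g"] add[of t "- t" g] by (simp add: zero)

text \<open>The orbits are continuous and all \<open>U t\<close> have Lipschitz constant \<open>1\<close>. Joint continuity gives
  the measurability of all integrands below, in which both the time and the vector vary.\<close>

lemma jointly_continuous: "continuous_on UNIV (\<lambda>x. U (fst x) (snd x))"
proof (intro continuous_at_imp_continuous_on ballI)
  fix x :: "real \<times> 'h"
  obtain t f where x: "x = (t, f)" by (cases x)
  \<comment> \<open>The two summands bound the change of the vector at fixed time and the change of time at fixed vector.\<close>
  have "((\<lambda>y. norm (snd y - f) + norm (U (fst y) f - U t f)) \<longlongrightarrow> norm (f - f) + norm (U t f - U t f)) (at x)"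
  proof (intro tendsto_intros)
    show "(snd \<longlongrightarrow> f) (at x)" using tendsto_snd[OF tendsto_ident_at, of x UNIV] by (simp add: x)
    have "(fst \<longlongrightarrow> t) (at x)" using tendsto_fst[OF tendsto_ident_at, of x UNIV] by (simp add: x)
    moreover have "isCont (\<lambda>t. U t f) t" using cont by (simp add: continuous_on_eq_continuous_at)
    ultimately show "((\<lambda>y. U (fst y) f) \<longlongrightarrow> U t f) (at x)"
      by (rule isCont_tendsto_compose[rotated])
  qed
  then have "((\<lambda>y. norm (snd y - f) + norm (U (fst y) f - U t f)) \<longlongrightarrow> 0) (at x)" by simp
  moreover have "\<forall>\<^sub>F y in at x. norm (U (fst y) (snd y) - U t f) \<le> norm (snd y - f) + norm (U (fst y) f - U t f)"
  proof (rule always_eventually, rule allI)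
    fix y
    have "U (fst y) (snd y) - U t f = U (fst y) (snd y - f) + (U (fst y) f - U t f)"
      by (simp add: diff)
    then show "norm (U (fst y) (snd y) - U t f) \<le> norm (snd y - f) + norm (U (fst y) f - U t f)"
      using norm_triangle_ineq[of "U (fst y) (snd y - f)" "U (fst y) f - U t f"] by (simp only: norm)
  qed
  ultimately have "((\<lambda>y. U (fst y) (snd y) - U t f) \<longlongrightarrow> 0) (at x)"
    by (rule Lim_null_comparison[rotated])
  then show "isCont (\<lambda>x. U (fst x) (snd x)) x"
    by (simp add: isCont_def x LIM_zero_iff)
qed

lemma measurable [measurable (raw)]:
  assumes "\<tau> \<in> borel_measurable M" "f \<in> borel_measurable M"
  shows "(\<lambda>x. U (\<tau> x) (f x)) \<in> borel_measurable M"
  using assms jointly_continuous by (rule borel_measurable_continuous_Pair)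

definition generates :: "'h \<Rightarrow> 'h \<Rightarrow> bool" where
  "generates f g \<longleftrightarrow> ((\<lambda>h. (1 / h) *\<^sub>R (U h f - f)) \<longlongrightarrow> g) (at 0)"

lemma generates_scaleR:
  assumes "generates f g"
  shows "generates (c *\<^sub>R f) (c *\<^sub>R g)"
proof -
  have "(\<lambda>h. (1 / h) *\<^sub>R (U h (c *\<^sub>R f) - c *\<^sub>R f)) = (\<lambda>h. c *\<^sub>R ((1 / h) *\<^sub>R (U h f - f)))"
    by (simp add: linear_scale[OF linear] scaleR_diff_right mult.commute)
  then show ?thesis
    using tendsto_scaleR[OF tendsto_const assms[unfolded generates_def], of c]
    unfolding generates_def by simp
qed

lemma has_real_derivative_inner:
  assumes "generates f g"
  shows "((\<lambda>t. U t f \<bullet> k) has_real_derivative (U t g \<bullet> k)) (at t)"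
proof -
  have "((\<lambda>h. U t ((1 / h) *\<^sub>R (U h f - f)) \<bullet> k) \<longlongrightarrow> U t g \<bullet> k) (at 0)"
    using assms unfolding generates_def
    by (intro tendsto_inner[OF bounded_linear.tendsto[OF bounded_linear] tendsto_const])
  moreover have "U t ((1 / h) *\<^sub>R (U h f - f)) \<bullet> k = (U (t + h) f \<bullet> k - U t f \<bullet> k) / h" for h
    by (simp add: linear_scale[OF linear] diff add inner_diff_left divide_inverse)
  ultimately show ?thesis unfolding DERIV_def by simp
qed

text \<open>Rescaling time by \<open>r\<close> turns the orbit of \<open>g\<close> into the derivative of the orbit of \<open>f\<close> divided
  by \<open>r\<close>. So the time integral sees only the end points of the orbit of \<open>f\<close>: it is small when
  \<open>f\<close> is small, however large \<open>g\<close> may be.\<close>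

lemma integral_orbit_bound:
  assumes gen: "generates f g" and r: "r \<noteq> 0" and T: "0 \<le> T"
  shows "\<bar>LINT s|lebesgue_on {0..T}. U ((s - c) * r) g \<bullet> k\<bar> \<le> 2 * norm f * norm k / \<bar>r\<bar>"
proof -
  have c: "continuous_on {0..T} (\<lambda>s. U ((s - c) * r) g \<bullet> k)"
    by (intro continuous_intros continuous_on_compose2[OF cont]) auto
  have "((\<lambda>s. U ((s - c) * r) f \<bullet> k / r) has_real_derivative (U ((s - c) * r) g \<bullet> k)) (at s within {0..T})" for s
  proof -
    have "((\<lambda>s. U ((s - c) * r) f \<bullet> k) has_real_derivative (U ((s - c) * r) g \<bullet> k) * r) (at s)"
      by (rule DERIV_chain2[OF has_real_derivative_inner[OF gen]]) (auto intro!: derivative_eq_intros)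
    from DERIV_cdivide[OF this, of r] show ?thesis
      using r by (simp add: has_field_derivative_at_within)
  qed
  then have "((\<lambda>s. U ((s - c) * r) g \<bullet> k) has_integral
      (U ((T - c) * r) f \<bullet> k / r - U ((0 - c) * r) f \<bullet> k / r)) {0..T}"
    using T by (intro fundamental_theorem_of_calculus) 
      (auto simp: has_real_derivative_iff_has_vector_derivative)
  moreover have "integrable (lebesgue_on {0..T}) (\<lambda>s. U ((s - c) * r) g \<bullet> k)"
    using continuous_imp_integrable_real[OF c] .
  ultimately have "(LINT s|lebesgue_on {0..T}. U ((s - c) * r) g \<bullet> k)
      = U ((T - c) * r) f \<bullet> k / r - U ((0 - c) * r) f \<bullet> k / r"
    by (simp add: lebesgue_integral_eq_integral integral_unique)
  also have "\<bar>\<dots>\<bar> \<le> (norm f * norm k + norm f * norm k) / \<bar>r\<bar>"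
  proof -
    have "\<bar>U t f \<bullet> k\<bar> \<le> norm f * norm k" for t
      using Cauchy_Schwarz_ineq2[of "U t f" k] by (simp add: norm)
    from add_mono[OF this this] show ?thesis
      by (auto simp: abs_divide diff_divide_distrib[symmetric] intro!: divide_right_mono order_trans[OF abs_triangle_ineq4])
  qed
  finally show ?thesis by simp
qed

text \<open>Smoothing an arbitrary vector along its orbit moves it into the domain of the generator.\<close>

lemma generates_orbit_integral:
  assumes "0 < a"
  shows "generates (integral {0..a} (\<lambda>t. U t f)) (U a f - f)"
proof -
  define I where "I x y = integral {x..y} (\<lambda>t. U t f)" for x y
  have ci: "continuous_on {x..y} (\<lambda>t. U t f)" for x y
    using cont by (rule continuous_on_subset) simp
  have int: "(\<lambda>t. U t f) integrable_on {x..y}" for x y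
    by (rule integrable_continuous_real[OF ci])
  \<comment> \<open>A primitive of the orbit based at \<open>-1\<close> is differentiable on both sides of \<open>0\<close>.\<close>
  define F where "F x = I (-1) x" for x
  have F: "I x y = F y - F x" if "-1 \<le> x" "x \<le> y" for x y
    unfolding F_def I_def using Henstock_Kurzweil_Integration.integral_combine[OF that int] by (simp add: algebra_simps)
  have dF: "(F has_vector_derivative U x f) (at x)" if "-1 < x" for x
  proof -
    have "(F has_vector_derivative U x f) (at x within {-1..x+1})"
      unfolding F_def I_def using that by (intro integral_has_vector_derivative ci) auto
    then have "(F has_vector_derivative U x f) (at x within {-1<..<x+1})"
      by (rule has_vector_derivative_within_subset) auto
    then show ?thesis using that by (subst (asm) has_vector_derivative_within_open) auto
  qed
  \<comment> \<open>Applying \<open>U h\<close> shifts the interval of integration by \<open>h\<close>.\<close>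
  have shift: "U h (I 0 a) = F (a + h) - F h" if "-1 < h" for h
  proof -
    have "U h (I 0 a) = integral {0..a} (\<lambda>t. U h (U t f))"
      unfolding I_def using integral_linear[OF int bounded_linear, of 0 a h] by (simp add: o_def)
    also have "\<dots> = integral {0..a} ((\<lambda>t. U t f) \<circ> (\<lambda>t. t + h))"
      by (simp add: o_def add add.commute[of _ h])
    also have "\<dots> = I h (a + h)"
      unfolding I_def using integral_shift_Icc_real[of 0 a "\<lambda>t. U t f" h] by (simp add: o_def add.commute)
    finally show ?thesis using F[of h "a + h"] that assms by simp
  qed
  have d: "((\<lambda>h. F (a + h) - F h) has_vector_derivative (U a f - U 0 f)) (at 0)"
  proof (intro derivative_intros)
    show "(F has_vector_derivative U 0 f) (at 0)" by (rule dF) simp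
    show "((\<lambda>h. F (a + h)) has_vector_derivative U a f) (at 0)"
    proof -
      have "((\<lambda>h. a + h) has_vector_derivative 1) (at 0)"
        using has_vector_derivative_add[OF has_vector_derivative_const has_vector_derivative_id] by simp
      then show ?thesis
        using vector_diff_chain_at[of "\<lambda>h. a + h" 1 0 F "U a f"] dF[of a] assms by (simp add: o_def)
    qed
  qed
  have "((\<lambda>h. (1 / h) *\<^sub>R (F (a + h) - F h - (F a - F 0))) \<longlongrightarrow> U a f - f) (at 0)"
    using has_vector_derivative_quotient[OF d] by (simp add: zero)
  moreover have "\<forall>\<^sub>F h in at 0. (1 / h) *\<^sub>R (F (a + h) - F h - (F a - F 0)) = (1 / h) *\<^sub>R (U h (I 0 a) - I 0 a)"
  proof -
    have "\<forall>\<^sub>F h::real in at 0. -1 < h"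
      using order_tendstoD(1)[OF tendsto_ident_at, of "-1::real" 0 UNIV] by simp
    then show ?thesis
    proof eventually_elim
      fix h :: real assume h: "-1 < h"
      have "I 0 a = F a - F 0" using F[of 0 a] assms by simp
      then show "(1 / h) *\<^sub>R (F (a + h) - F h - (F a - F 0)) = (1 / h) *\<^sub>R (U h (I 0 a) - I 0 a)"
        unfolding shift[OF h] by simp
    qed
  qed
  ultimately show ?thesis
    unfolding generates_def I_def[symmetric] by (rule Lim_transform_eventually)
qed

lemma orbit_integral_nonzero:
  assumes "f \<noteq> 0"
  shows "\<exists>a>0. integral {0..a} (\<lambda>t. U t f) \<noteq> 0"
proof (rule ccontr)
  assume "\<not> ?thesis"
  then have z: "integral {0..a} (\<lambda>t. U t f) = 0" if "0 \<le> a" for a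
    using that by (cases "a = 0") auto
  have ci: "continuous_on {0..1} (\<lambda>t. U t f)"
    using cont by (rule continuous_on_subset) simp
  have "((\<lambda>u. integral {0..u} (\<lambda>t. U t f)) has_vector_derivative U 0 f) (at 0 within {0..1})"
    by (rule integral_has_vector_derivative[OF ci]) simp
  then have "((\<lambda>u. 0 :: 'h) has_vector_derivative U 0 f) (at 0 within {0..1})"
    by (rule has_vector_derivative_transform[rotated 2]) (auto simp: z)
  moreover have "((\<lambda>u. 0 :: 'h) has_vector_derivative 0) (at (0::real) within {0..1})"
    by (rule has_vector_derivative_const)
  ultimately have "U 0 f = 0"
    using vector_derivative_unique_within[of "0::real" "{0..1}"]
    by (metis at_within_Icc_at_right trivial_limit_at_right_real zero_less_one)
  with assms show False by (simp add: zero)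
qed

text \<open>This is a form of Wiener's lemma. The squared norm of the average is a double average over
  pairs of independent values of \<open>\<alpha>\<close>. Only the difference of the two values enters, and for a
  nonzero difference the time integral is controlled by \<open>\<psi> n\<close>. Pairs of equal values have
  probability zero because the law of \<open>\<alpha>\<close> has no atoms.\<close>

lemma averaged_orbits_vanish:
  fixes M :: "'w measure" and \<alpha> :: "'w \<Rightarrow> real"
  assumes "prob_space M" and \<alpha> [measurable]: "\<alpha> \<in> borel_measurable M"
    and atomless: "\<And>c. AE \<omega> in M. \<alpha> \<omega> \<noteq> c"
    and gen: "\<And>n. generates (\<psi> n) (\<phi> n)" and \<phi>: "\<And>n. norm (\<phi> n) = 1" and \<psi>: "\<psi> \<longlonglongrightarrow> 0"
    and T: "0 \<le> T"
  shows "(\<lambda>n. LINT s|lebesgue_on {0..T}. (norm (LINT \<omega>|M. U ((s - T) * \<alpha> \<omega>) (\<phi> n)))\<^sup>2) \<longlonglongrightarrow> 0"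
proof -
  interpret prob_space M by fact
  define L where "L = lebesgue_on {0..T}"
  interpret L: finite_measure L
    unfolding L_def by (rule finite_measure_lebesgue_on) simp
  interpret MM: pair_prob_space M M ..
  interpret MML: pair_sigma_finite "M \<Otimes>\<^sub>M M" L ..
  have L_id [measurable]: "(\<lambda>s. s) \<in> borel_measurable L"
    unfolding L_def by (intro measurable_restrict_space1 measurable_completion) simp
  have L_T: "measure L (space L) = T"
    using T by (simp add: L_def measure_restrict_space)
  \<comment> \<open>The correlation of two orbits of \<open>\<phi> n\<close> that run at the speeds \<open>\<alpha> (fst p)\<close> and \<open>\<alpha> (snd p)\<close>.\<close>
  define h where "h n p s = U ((s - T) * (\<alpha> (fst p) - \<alpha> (snd p))) (\<phi> n) \<bullet> \<phi> n" for n p s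
  have h_meas [measurable]: "(\<lambda>x. h n (fst x) (snd x)) \<in> borel_measurable ((M \<Otimes>\<^sub>M M) \<Otimes>\<^sub>M L)" for n
  proof -
    have [measurable]: "snd \<in> borel_measurable ((M \<Otimes>\<^sub>M M) \<Otimes>\<^sub>M L)"
      using measurable_compose[OF measurable_snd L_id] by simp
    show ?thesis unfolding h_def by measurable
  qed
  have h_le: "\<bar>h n p s\<bar> \<le> 1" for n p s
    using Cauchy_Schwarz_ineq2[of "U ((s - T) * (\<alpha> (fst p) - \<alpha> (snd p))) (\<phi> n)" "\<phi> n"]
    by (simp add: h_def norm \<phi>)
  have h_int: "integrable ((M \<Otimes>\<^sub>M M) \<Otimes>\<^sub>M L) (\<lambda>(p, s). h n p s)" for n
  proof -
    interpret MMLf: finite_measure "(M \<Otimes>\<^sub>M M) \<Otimes>\<^sub>M L"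
      by (intro finite_measure_pair_measure) unfold_locales
    show ?thesis
      by (rule MMLf.integrable_const_bound[where B = 1]) (auto simp: h_le case_prod_unfold)
  qed
  have norm_q: "(norm (LINT \<omega>|M. U ((s - T) * \<alpha> \<omega>) (\<phi> n)))\<^sup>2 = (LINT p|(M \<Otimes>\<^sub>M M). h n p s)" for n s
  proof -
    define V where "V \<omega> = U ((s - T) * \<alpha> \<omega>) (\<phi> n)" for \<omega>
    have V_meas [measurable]: "V \<in> borel_measurable M" unfolding V_def by measurable
    have V_int: "integrable M V"
      by (rule integrable_const_bound[where B = 1]) (auto simp: V_def norm \<phi>)
    have VV: "V \<omega> \<bullet> V \<omega>' = h n (\<omega>, \<omega>') s" for \<omega> \<omega>'
    proof -
      have "V \<omega> \<bullet> V \<omega>' = U (- ((s - T) * \<alpha> \<omega>')) (V \<omega>) \<bullet> \<phi> n"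
        unfolding V_def[of \<omega>'] by (subst adjoint) simp
      also have "\<dots> = U (- ((s - T) * \<alpha> \<omega>') + (s - T) * \<alpha> \<omega>) (\<phi> n) \<bullet> \<phi> n"
        by (simp only: V_def add)
      finally show ?thesis by (simp add: h_def algebra_simps)
    qed
    have "(\<lambda>p. V (fst p) \<bullet> V (snd p)) \<in> borel_measurable (M \<Otimes>\<^sub>M M)" by measurable
    then have "integrable (M \<Otimes>\<^sub>M M) (\<lambda>p. V (fst p) \<bullet> V (snd p))"
      by (intro MM.integrable_const_bound[where B = 1]) (simp_all add: VV h_le)
    then have int: "integrable (M \<Otimes>\<^sub>M M) (\<lambda>(\<omega>, \<omega>'). V \<omega> \<bullet> V \<omega>')" by (simp add: case_prod_unfold)
    have "(norm (integral\<^sup>L M V))\<^sup>2 = integral\<^sup>L M V \<bullet> integral\<^sup>L M V" by (rule power2_norm_eq_inner)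
    also have "\<dots> = (LINT \<omega>|M. V \<omega> \<bullet> integral\<^sup>L M V)" using V_int by simp
    also have "\<dots> = (LINT \<omega>|M. LINT \<omega>'|M. V \<omega> \<bullet> V \<omega>')" using V_int by simp
    also have "\<dots> = (LINT p|(M \<Otimes>\<^sub>M M). V (fst p) \<bullet> V (snd p))"
      using MM.integral_fst[OF int] by (simp add: case_prod_unfold)
    finally have "(norm (integral\<^sup>L M V))\<^sup>2 = (LINT p|(M \<Otimes>\<^sub>M M). h n p s)" by (simp add: VV)
    then show ?thesis by (simp only: V_def[abs_def])
  qed
  have "(LINT s|L. (norm (LINT \<omega>|M. U ((s - T) * \<alpha> \<omega>) (\<phi> n)))\<^sup>2) = (LINT p|(M \<Otimes>\<^sub>M M). LINT s|L. h n p s)" for n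
    unfolding norm_q by (rule MML.Fubini_integral[OF h_int])
  moreover have "(\<lambda>n. LINT p|(M \<Otimes>\<^sub>M M). LINT s|L. h n p s) \<longlonglongrightarrow> (LINT p|(M \<Otimes>\<^sub>M M). 0)"
  proof (rule integral_dominated_convergence[where w = "\<lambda>_. T"])
    have "{p \<in> space (M \<Otimes>\<^sub>M M). \<alpha> (fst p) \<noteq> \<alpha> (snd p)} \<in> sets (M \<Otimes>\<^sub>M M)" by measurable
    moreover have "AE \<omega> in M. AE \<omega>' in M. \<alpha> \<omega> \<noteq> \<alpha> \<omega>'"
    proof (rule AE_I2)
      show "AE \<omega>' in M. \<alpha> \<omega> \<noteq> \<alpha> \<omega>'" for \<omega>
        using atomless[of "\<alpha> \<omega>"] by eventually_elim simp
    qed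
    ultimately have "AE p in (M \<Otimes>\<^sub>M M). \<alpha> (fst p) \<noteq> \<alpha> (snd p)"
      by (intro MM.AE_pair_measure) auto
    then show "AE p in (M \<Otimes>\<^sub>M M). (\<lambda>n. LINT s|L. h n p s) \<longlonglongrightarrow> 0"
    proof eventually_elim
      case (elim p)
      define r where "r = \<alpha> (fst p) - \<alpha> (snd p)"
      have "\<forall>n. norm (LINT s|L. h n p s) \<le> norm (\<psi> n) * (2 / \<bar>r\<bar>)"
      proof
        show "norm (LINT s|L. h n p s) \<le> norm (\<psi> n) * (2 / \<bar>r\<bar>)" for n
          using integral_orbit_bound[OF gen[of n] _ T, where r = r and c = T and k = "\<phi> n"] elim by (simp add: h_def r_def L_def \<phi> mult.commute)
      qed
      moreover have "(\<lambda>n. norm (\<psi> n) * (2 / \<bar>r\<bar>)) \<longlonglongrightarrow> 0"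
        using tendsto_mult_left_zero[OF tendsto_norm_zero[OF \<psi>]] .
      ultimately show ?case
        by (rule Lim_null_comparison[OF always_eventually])
    qed
    show "AE p in (M \<Otimes>\<^sub>M M). norm (LINT s|L. h n p s) \<le> T" for n
    proof (rule AE_I2)
      fix p assume p: "p \<in> space (M \<Otimes>\<^sub>M M)"
      have hp: "(\<lambda>s. h n p s) \<in> borel_measurable L"
        using measurable_compose[OF measurable_Pair1'[OF p, of L] h_meas[of n]] by simp
      have "integrable L (\<lambda>s. h n p s)"
        by (rule L.integrable_const_bound[where B = 1]) (auto simp: h_le hp)
      then have "norm (LINT s|L. h n p s) \<le> (LINT s|L. 1)"
        by (rule Bochner_Integration.integral_norm_bound_integral) (auto simp: h_le)
      then show "norm (LINT s|L. h n p s) \<le> T" by (simp add: L_T)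
    qed
    show "(\<lambda>p. LINT s|L. h n p s) \<in> borel_measurable (M \<Otimes>\<^sub>M M)" for n
      using h_meas by (intro L.borel_measurable_lebesgue_integral) (simp add: case_prod_unfold)
  qed auto
  ultimately show ?thesis by (simp add: L_def)
qed

text \<open>Moving \<open>U\<close> to the other side of the inner product and exchanging the integrals pairs the
  control \<open>v\<close> with the averaged backward orbit of \<open>k\<close>. The parameter \<open>\<epsilon>\<close> comes from Young's
  inequality \<open>2 a b \<le> \<epsilon> a^2 + b^2 / \<epsilon>\<close>.\<close>

lemma averaged_duality_bound:
  fixes M :: "'w measure" and \<alpha> :: "'w \<Rightarrow> real"
  assumes "prob_space M" and \<alpha> [measurable]: "\<alpha> \<in> borel_measurable M" and T: "0 \<le> T"
    and v: "(\<integral>\<^sup>+s. ennreal ((norm (v s))\<^sup>2) \<partial>lebesgue_on {0..T}) \<le> ennreal c"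
    and c: "0 \<le> c" and \<epsilon>: "0 < \<epsilon>"
  shows "2 * ((LINT \<omega>|M. LINT s|lebesgue_on {0..T}. U ((T - s) * \<alpha> \<omega>) (v s)) \<bullet> k)
    \<le> \<epsilon> * c + (LINT s|lebesgue_on {0..T}. (norm (LINT \<omega>|M. U ((s - T) * \<alpha> \<omega>) k))\<^sup>2) / \<epsilon>"
proof -
  interpret prob_space M by fact
  define L where "L = lebesgue_on {0..T}"
  interpret L: finite_measure L
    unfolding L_def by (rule finite_measure_lebesgue_on) simp
  interpret PL: pair_sigma_finite M L ..
  have L_id [measurable]: "(\<lambda>s. s) \<in> borel_measurable L"
    unfolding L_def by (intro measurable_restrict_space1 measurable_completion) simp
  have snd_meas [measurable]: "snd \<in> borel_measurable (M \<Otimes>\<^sub>M L)"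
    using measurable_compose[OF measurable_snd L_id] by simp
  define W where "W \<omega> s = U ((T - s) * \<alpha> \<omega>) (v s)" for \<omega> s
  define q where "q s = (LINT \<omega>|M. U ((s - T) * \<alpha> \<omega>) k)" for s
  have q_nonneg: "0 \<le> (LINT s|L. (norm (q s))\<^sup>2)" by simp
  have "2 * ((LINT \<omega>|M. LINT s|L. W \<omega> s) \<bullet> k) \<le> \<epsilon> * c + (LINT s|L. (norm (q s))\<^sup>2) / \<epsilon>"
  proof (cases "v \<in> borel_measurable L")
    case False
    \<comment> \<open>The control can be recovered from \<open>W\<close> by the inverse group, so for no \<open>\<omega>\<close> is \<open>W \<omega>\<close> measurable, and its Bochner integral has the default value \<open>0\<close>.\<close>
    have "(LINT s|L. W \<omega> s) = 0" for \<omega>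
    proof (rule not_integrable_integral_eq, rule notI)
      assume "integrable L (W \<omega>)"
      then have [measurable]: "W \<omega> \<in> borel_measurable L" by (rule borel_measurable_integrable)
      have "(\<lambda>s. U (- ((T - s) * \<alpha> \<omega>)) (W \<omega> s)) \<in> borel_measurable L" by measurable
      moreover have "U (- ((T - s) * \<alpha> \<omega>)) (W \<omega> s) = v s" for s
        unfolding W_def add[symmetric] by (simp add: zero)
      ultimately show False using False by simp
    qed
    then show ?thesis using c \<epsilon> q_nonneg by simp
  next
    case True
    then have v_meas [measurable]: "v \<in> borel_measurable L" .
    have v2: "integrable L (\<lambda>s. (norm (v s))\<^sup>2)"
      using le_less_trans[OF v ennreal_less_top] by (intro integrableI_bounded) (auto simp: L_def[symmetric])
    have v2_le: "(LINT s|L. (norm (v s))\<^sup>2) \<le> c"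
      using v c nn_integral_eq_integral[OF v2] by (simp add: L_def[symmetric])
    have v_int: "integrable L v"
    proof (rule Bochner_Integration.integrable_bound)
      show "integrable L (\<lambda>s. 1 + (norm (v s))\<^sup>2)" using v2 by simp
      have "norm (v s) \<le> 1 + (norm (v s))\<^sup>2" for s
        using zero_le_power2[of "norm (v s) - 1 / 2"] by (simp add: power2_diff power_divide)
      then show "AE s in L. norm (v s) \<le> norm (1 + (norm (v s))\<^sup>2)" by (auto intro: order_trans)
    qed fact
    have W_meas [measurable]: "(\<lambda>p. W (fst p) (snd p)) \<in> borel_measurable (M \<Otimes>\<^sub>M L)"
      unfolding W_def by measurable
    have norm_W: "norm (W \<omega> s) = norm (v s)" for \<omega> s by (simp add: W_def norm)
    have W_int: "integrable L (W \<omega>)" if "\<omega> \<in> space M" for \<omega>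
      using v_int
    proof (rule Bochner_Integration.integrable_bound)
      show "W \<omega> \<in> borel_measurable L" unfolding W_def by measurable
    qed (simp add: norm_W)
    have WW_int: "integrable (M \<Otimes>\<^sub>M L) (\<lambda>p. W (fst p) (snd p))"
      by (rule PL.Fubini_integrable) (use W_int in \<open>auto simp: norm_W\<close>)
    have Wk_int: "integrable (M \<Otimes>\<^sub>M L) (\<lambda>(\<omega>, s). W \<omega> s \<bullet> k)"
      using integrable_inner_left[OF WW_int, of k] by (simp add: case_prod_unfold)
    have "integrable M (\<lambda>\<omega>. LINT s|L. W \<omega> s)"
      using PL.integrable_fst[of W] WW_int by (simp add: case_prod_unfold)
    then have "(LINT \<omega>|M. LINT s|L. W \<omega> s) \<bullet> k = (LINT \<omega>|M. (LINT s|L. W \<omega> s) \<bullet> k)"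
      by simp
    also have "\<dots> = (LINT \<omega>|M. LINT s|L. W \<omega> s \<bullet> k)"
      by (rule Bochner_Integration.integral_cong[OF refl]) (simp add: W_int)
    also have "\<dots> = (LINT s|L. LINT \<omega>|M. W \<omega> s \<bullet> k)"
      by (rule PL.Fubini_integral[OF Wk_int, symmetric])
    also have "\<dots> = (LINT s|L. v s \<bullet> q s)"
    proof (rule Bochner_Integration.integral_cong[OF refl])
      fix s
      have "integrable M (\<lambda>\<omega>. U ((s - T) * \<alpha> \<omega>) k)"
        by (rule integrable_const_bound[where B = "norm k"]) (auto simp: norm)
      moreover have "W \<omega> s \<bullet> k = v s \<bullet> U ((s - T) * \<alpha> \<omega>) k" for \<omega>
        using adjoint[of "(T - s) * \<alpha> \<omega>" "v s" k] by (simp add: W_def algebra_simps)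
      ultimately show "(LINT \<omega>|M. W \<omega> s \<bullet> k) = v s \<bullet> q s" by (simp add: q_def)
    qed
    finally have eq: "(LINT \<omega>|M. LINT s|L. W \<omega> s) \<bullet> k = (LINT s|L. v s \<bullet> q s)" .
    have q_meas [measurable]: "q \<in> borel_measurable L"
    proof -
      have [measurable]: "fst \<in> borel_measurable (L \<Otimes>\<^sub>M M)"
        using measurable_compose[OF measurable_fst L_id] by simp
      have "(\<lambda>(s, \<omega>). U ((s - T) * \<alpha> \<omega>) k) \<in> borel_measurable (L \<Otimes>\<^sub>M M)"
        unfolding case_prod_unfold by measurable
      then show ?thesis unfolding q_def[abs_def] by (rule borel_measurable_lebesgue_integral)
    qed
    have q_le: "norm (q s) \<le> norm k" for s
    proof -
      have "norm (q s) \<le> (LINT \<omega>|M. norm (U ((s - T) * \<alpha> \<omega>) k))"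
        unfolding q_def by (rule integral_norm_bound)
      then show ?thesis by (simp add: norm prob_space)
    qed
    have q2: "integrable L (\<lambda>s. (norm (q s))\<^sup>2)"
      by (rule L.integrable_const_bound[where B = "(norm k)\<^sup>2"]) (auto simp: q_le power_mono)
    have young: "v s \<bullet> q s \<le> \<epsilon> / 2 * (norm (v s))\<^sup>2 + 1 / (2 * \<epsilon>) * (norm (q s))\<^sup>2" for s
    proof -
      have "0 \<le> (\<epsilon> * norm (v s) - norm (q s))\<^sup>2 / (2 * \<epsilon>)" using \<epsilon> by simp
      then have "norm (v s) * norm (q s) \<le> \<epsilon> / 2 * (norm (v s))\<^sup>2 + 1 / (2 * \<epsilon>) * (norm (q s))\<^sup>2"
        using \<epsilon> by (simp add: power2_eq_square field_simps)
      then show ?thesis using norm_cauchy_schwarz[of "v s" "q s"] by linarith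
    qed
    have "(LINT s|L. v s \<bullet> q s) \<le> (LINT s|L. \<epsilon> / 2 * (norm (v s))\<^sup>2 + 1 / (2 * \<epsilon>) * (norm (q s))\<^sup>2)"
      using v2 q2 q_nonneg \<epsilon> young by (intro integral_mono') auto
    also have "\<dots> = \<epsilon> / 2 * (LINT s|L. (norm (v s))\<^sup>2) + 1 / (2 * \<epsilon>) * (LINT s|L. (norm (q s))\<^sup>2)"
      using v2 q2 by simp
    also have "\<dots> \<le> \<epsilon> / 2 * c + 1 / (2 * \<epsilon>) * (LINT s|L. (norm (q s))\<^sup>2)"
      using v2_le \<epsilon> by simp
    finally show ?thesis unfolding eq using \<epsilon> by (simp add: field_simps)
  qed
  then show ?thesis by (simp only: L_def W_def q_def)
qed

end

section \<open>Calculus of test functions\<close>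

lemma dir_deriv_at:
  assumes "(f has_derivative D) (at x)"
  shows "dir_deriv b f x = D b"
  using frechet_derivative_at[OF assms] by (simp add: dir_deriv_def)

lemma has_dir_deriv:
  assumes "f differentiable (at x)"
  shows "(f has_derivative (\<lambda>b. dir_deriv b f x)) (at x)"
  using assms by (simp add: dir_deriv_def frechet_derivative_works[symmetric])

lemma dir_deriv_mult:
  assumes "f differentiable (at x)" "g differentiable (at x)"
  shows "dir_deriv b (\<lambda>x. f x * g x) x = f x * dir_deriv b g x + dir_deriv b f x * g x"
  using has_derivative_mult[OF has_dir_deriv[OF assms(1)] has_dir_deriv[OF assms(2)]]
  by (rule dir_deriv_at)

lemma dir_deriv_add:
  assumes "f differentiable (at x)" "g differentiable (at x)"
  shows "dir_deriv b (\<lambda>x. f x + g x) x = dir_deriv b f x + dir_deriv b g x"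
  using has_derivative_add[OF has_dir_deriv[OF assms(1)] has_dir_deriv[OF assms(2)]]
  by (rule dir_deriv_at)

lemma C_k_differentiable: "C_k (Suc k) f \<Longrightarrow> f differentiable (at x)"
  by simp

lemma C_k_dir_deriv: "C_k (Suc k) f \<Longrightarrow> b \<in> Basis \<Longrightarrow> C_k k (dir_deriv b f)"
  by simp

text \<open>The recursion constrains only the derivatives, so that the classes \<open>C_k\<close> decrease in \<open>k\<close> has
  to be derived: differentiability gives continuity at the base.\<close>

lemma C_k_Suc: "C_k (Suc k) f \<Longrightarrow> C_k k f"
proof (induction k arbitrary: f)
  case 0
  then have "isCont f x" for x
    using differentiable_imp_continuous_within C_k_differentiable by blast
  then show ?case by (simp add: continuous_on_eq_continuous_at)
next
  case (Suc k)
  then have "C_k k (dir_deriv b f)" if "b \<in> Basis" for b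
    using C_k_dir_deriv[OF Suc.prems that] by blast
  with Suc.prems show ?case by simp
qed

lemma C_k_add: "C_k k f \<Longrightarrow> C_k k g \<Longrightarrow> C_k k (\<lambda>x. f x + g x)"
proof (induction k arbitrary: f g)
  case (Suc k)
  have d: "f differentiable (at x)" "g differentiable (at x)" for x
    using Suc.prems by (auto intro: C_k_differentiable)
  then have "dir_deriv b (\<lambda>x. f x + g x) = (\<lambda>x. dir_deriv b f x + dir_deriv b g x)" for b
    by (simp add: fun_eq_iff dir_deriv_add)
  with Suc d show ?case by (auto intro!: differentiable_add)
qed (auto intro: continuous_on_add)

lemma C_k_mult: "C_k k f \<Longrightarrow> C_k k g \<Longrightarrow> C_k k (\<lambda>x. f x * g x)"
proof (induction k arbitrary: f g)
  case (Suc k)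
  have d: "f differentiable (at x)" "g differentiable (at x)" for x
    using Suc.prems by (auto intro: C_k_differentiable)
  have "C_k k (dir_deriv b (\<lambda>x. f x * g x))" if "b \<in> Basis" for b
  proof -
    have "C_k k (\<lambda>x. f x * dir_deriv b g x + dir_deriv b f x * g x)"
      using Suc.prems[THEN C_k_Suc] Suc.prems[THEN C_k_dir_deriv[OF _ that]]
      by (intro C_k_add Suc.IH)
    then show ?thesis using d by (subst ext[OF dir_deriv_mult]) auto
  qed
  with d show ?case by (auto intro!: differentiable_mult)
qed (auto intro: continuous_on_mult)

lemma C_k_const: "C_k m (\<lambda>x. c)"
proof (induction m arbitrary: c)
  case (Suc m)
  have "dir_deriv b (\<lambda>x. c) = (\<lambda>x. 0)" for b :: 'a
    by (rule ext) (rule dir_deriv_at[OF has_derivative_const])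
  with Suc show ?case by simp
qed simp

lemma C_k_sum:
  assumes "finite I" "\<And>i. i \<in> I \<Longrightarrow> C_k k (f i)"
  shows "C_k k (\<lambda>x. \<Sum>i\<in>I. f i x)"
  using assms
proof (induction I rule: finite_induct)
  case (insert i I)
  have "C_k k (\<lambda>x. f i x + (\<Sum>i\<in>I. f i x))"
    by (intro C_k_add insert.IH insert.prems) simp_all
  with insert.hyps show ?case by simp
qed (simp add: C_k_const)

lemma test_function_C_k: "test_function G \<phi> \<Longrightarrow> C_k k \<phi>"
  by (simp add: test_function_def)

lemma test_function_differentiable: "test_function G \<phi> \<Longrightarrow> \<phi> differentiable (at x)"
  by (rule C_k_differentiable[OF test_function_C_k[of G \<phi> "Suc 0"]])

lemma test_function_continuous: "test_function G \<phi> \<Longrightarrow> continuous_on UNIV \<phi>"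
  using test_function_C_k[of G \<phi> 0] by simp

lemma zero_outside_support:
  "x \<notin> closure {x. \<phi> x \<noteq> 0} \<Longrightarrow> \<phi> x = 0"
  using subsetD[OF closure_subset, of x "{x. \<phi> x \<noteq> 0}"] by (cases "\<phi> x = 0") simp_all

lemma test_function_subset_support:
  assumes "test_function G \<phi>" "\<And>k. C_k k \<eta>" "{x. \<eta> x \<noteq> 0} \<subseteq> closure {x. \<phi> x \<noteq> 0}"
  shows "test_function G \<eta>"
proof -
  have sub: "closure {x. \<eta> x \<noteq> 0} \<subseteq> closure {x. \<phi> x \<noteq> 0}"
    using closure_minimal[OF assms(3) closed_closure] .
  have K: "compact (closure {x. \<phi> x \<noteq> 0})" "closure {x. \<phi> x \<noteq> 0} \<subseteq> G"
    using assms(1) by (simp_all only: test_function_def)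
  have "closure {x. \<phi> x \<noteq> 0} \<inter> closure {x. \<eta> x \<noteq> 0} = closure {x. \<eta> x \<noteq> 0}"
    using sub by (rule Int_absorb1)
  with compact_Int_closed[OF K(1) closed_closure, of "{x. \<eta> x \<noteq> 0}"]
  have "compact (closure {x. \<eta> x \<noteq> 0})" by simp
  with assms(2) subset_trans[OF sub K(2)] show ?thesis
    by (simp add: test_function_def)
qed

lemma test_function_mult:
  assumes "test_function G \<phi>" "\<And>k. C_k k \<eta>"
  shows "test_function G (\<lambda>x. \<eta> x * \<phi> x)"
  using assms(1)
proof (rule test_function_subset_support)
  show "C_k k (\<lambda>x. \<eta> x * \<phi> x)" for k
    using assms by (intro C_k_mult) (auto intro: test_function_C_k)
  show "{x. \<eta> x * \<phi> x \<noteq> 0} \<subseteq> closure {x. \<phi> x \<noteq> 0}"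
    by (rule subset_trans[OF _ closure_subset]) auto
qed

text \<open>Outside the closed support the function vanishes on a neighbourhood.\<close>

lemma support_dir_deriv: "{x. dir_deriv b \<phi> x \<noteq> 0} \<subseteq> closure {x. \<phi> x \<noteq> 0}"
proof
  fix x assume "x \<in> {x. dir_deriv b \<phi> x \<noteq> 0}"
  then have nz: "dir_deriv b \<phi> x \<noteq> 0" by simp
  show "x \<in> closure {x. \<phi> x \<noteq> 0}"
  proof (rule ccontr)
    assume "x \<notin> closure {x. \<phi> x \<noteq> 0}"
    then have x: "x \<in> - closure {x. \<phi> x \<noteq> 0}" by simp
    have "(\<phi> has_derivative (\<lambda>_. 0)) (at x)"
      using has_derivative_const[of 0 "at x"]
    proof (rule has_derivative_transform_within_open[OF _ _ x])
      show "open (- closure {x. \<phi> x \<noteq> 0})" by (intro open_Compl closed_closure)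
      show "0 = \<phi> y" if "y \<in> - closure {x. \<phi> x \<noteq> 0}" for y
        using that zero_outside_support[of y \<phi>] by simp
    qed
    from dir_deriv_at[OF this, of b] nz show False by simp
  qed
qed

lemma test_function_dir_deriv:
  assumes \<phi>: "test_function G \<phi>" and b: "b \<in> Basis"
  shows "test_function G (dir_deriv b \<phi>)"
  using \<phi> C_k_dir_deriv[OF test_function_C_k[OF \<phi>] b] support_dir_deriv
  by (rule test_function_subset_support)

lemma test_function_laplace:
  assumes \<phi>: "test_function G \<phi>"
  shows "test_function G (laplace \<phi>)"
  using \<phi>
proof (rule test_function_subset_support)
  have "laplace \<phi> = (\<lambda>x. \<Sum>b\<in>Basis. dir_deriv b (dir_deriv b \<phi>) x)"
    by (simp add: fun_eq_iff laplace_def)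
  moreover have "C_k k (\<lambda>x. \<Sum>b\<in>Basis. dir_deriv b (dir_deriv b \<phi>) x)" for k
  proof (rule C_k_sum)
    show "C_k k (dir_deriv b (dir_deriv b \<phi>))" if "b \<in> Basis" for b
      by (rule test_function_C_k[OF test_function_dir_deriv[OF test_function_dir_deriv[OF \<phi> that] that]])
  qed simp
  ultimately show "C_k k (laplace \<phi>)" for k by simp
  show "{x. laplace \<phi> x \<noteq> 0} \<subseteq> closure {x. \<phi> x \<noteq> 0}"
  proof
    fix x assume "x \<in> {x. laplace \<phi> x \<noteq> 0}"
    then obtain b where "dir_deriv b (dir_deriv b \<phi>) x \<noteq> 0"
      unfolding laplace_def mem_Collect_eq by (rule sum.not_neutral_contains_not_neutral)
    then have "x \<in> closure {x. dir_deriv b \<phi> x \<noteq> 0}"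
      using subsetD[OF support_dir_deriv[of b "dir_deriv b \<phi>"], of x] by simp
    then show "x \<in> closure {x. \<phi> x \<noteq> 0}"
      by (rule subsetD[OF closure_minimal[OF support_dir_deriv closed_closure]])
  qed
qed

lemma test_function_bounded:
  assumes "test_function G \<phi>"
  obtains B where "\<And>x. cmod (\<phi> x) \<le> B" "0 \<le> B"
proof -
  let ?K = "closure {x. \<phi> x \<noteq> 0}"
  have "compact (\<phi> ` ?K)"
    using assms by (intro compact_continuous_image continuous_on_subset[OF test_function_continuous[OF assms]])
      (auto simp: test_function_def)
  then obtain B where B: "B > 0" "\<And>x. x \<in> ?K \<Longrightarrow> cmod (\<phi> x) \<le> B"
    using compact_imp_bounded[of "\<phi> ` ?K"] by (auto simp: bounded_pos)
  have "cmod (\<phi> x) \<le> B" for x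
    using B zero_outside_support[of x \<phi>] by (cases "x \<in> ?K") auto
  then show ?thesis using B(1) that[of B] by simp
qed

lemma integrable_continuous_compact_support:
  fixes f :: "'a::euclidean_space \<Rightarrow> 'b::{banach, second_countable_topology}"
  assumes "continuous_on UNIV f" "compact K" "\<And>x. x \<notin> K \<Longrightarrow> f x = 0"
  shows "integrable lebesgue f"
proof -
  have "integrable lborel (\<lambda>x. indicator K x *\<^sub>R f x)"
    using assms by (intro borel_integrable_compact) (auto intro: continuous_on_subset)
  moreover have "(\<lambda>x. indicator K x *\<^sub>R f x) = f"
    using assms(3) by (auto simp: indicator_def fun_eq_iff)
  ultimately have "integrable lborel f" by simp
  then show ?thesis
    by (simp add: integrable_completion borel_measurable_integrable)
qed

lemma test_function_integrable:
  assumes "test_function G \<phi>"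
  shows "integrable lebesgue \<phi>"
proof (rule integrable_continuous_compact_support[OF test_function_continuous[OF assms]])
  show "compact (closure {x. \<phi> x \<noteq> 0})" using assms by (simp only: test_function_def)
  show "\<phi> x = 0" if "x \<notin> closure {x. \<phi> x \<noteq> 0}" for x
    using that by (rule zero_outside_support)
qed

lemma test_function_measurable:
  assumes "test_function G \<phi>"
  shows "\<phi> \<in> borel_measurable lebesgue"
  using test_function_integrable[OF assms] by (rule borel_measurable_integrable)

lemma test_function_square_integrable:
  assumes "test_function G \<phi>"
  shows "square_integrable \<phi>"
proof -
  have "integrable lebesgue (\<lambda>x. (cmod (\<phi> x))\<^sup>2)"
  proof (rule integrable_continuous_compact_support)
    show "continuous_on UNIV (\<lambda>x. (cmod (\<phi> x))\<^sup>2)"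
      by (intro continuous_intros test_function_continuous[OF assms])
    show "compact (closure {x. \<phi> x \<noteq> 0})" using assms by (simp add: test_function_def)
    show "(cmod (\<phi> x))\<^sup>2 = 0" if "x \<notin> closure {x. \<phi> x \<noteq> 0}" for x
      using zero_outside_support[of x \<phi>] that by simp
  qed
  then show ?thesis
    using test_function_measurable[OF assms] by (simp add: square_integrable_def)
qed

lemma has_vector_derivative_along_line:
  assumes "\<phi> differentiable (at (x + t *\<^sub>R b))"
  shows "((\<lambda>t. \<phi> (x + t *\<^sub>R b)) has_vector_derivative dir_deriv b \<phi> (x + t *\<^sub>R b)) (at t)"
proof -
  note D = has_dir_deriv[OF assms]
  have "((\<lambda>t. x + t *\<^sub>R b) has_derivative (\<lambda>s. s *\<^sub>R b)) (at t)"
    by (auto intro!: derivative_eq_intros)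
  then have "((\<lambda>t. \<phi> (x + t *\<^sub>R b)) has_derivative (\<lambda>s. dir_deriv (s *\<^sub>R b) \<phi> (x + t *\<^sub>R b))) (at t)"
    using D by (rule has_derivative_compose)
  moreover have "dir_deriv (s *\<^sub>R b) \<phi> (x + t *\<^sub>R b) = s *\<^sub>R dir_deriv b \<phi> (x + t *\<^sub>R b)" for s
    by (rule linear_scale[OF has_derivative_linear[OF D]])
  ultimately show ?thesis by (simp add: has_vector_derivative_def)
qed

lemma difference_quotient_bound:
  assumes \<phi>: "test_function G \<phi>" and B: "\<And>x. cmod (dir_deriv b \<phi> x) \<le> B"
  shows "cmod (\<phi> (x + h *\<^sub>R b) - \<phi> x) \<le> B * \<bar>h\<bar>"
proof -
  have "cmod (\<phi> (x + h *\<^sub>R b) - \<phi> (x + 0 *\<^sub>R b)) \<le> B * norm (h - 0)"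
  proof (rule differentiable_bound[where S = UNIV])
    show "((\<lambda>t. \<phi> (x + t *\<^sub>R b)) has_derivative (\<lambda>s. s *\<^sub>R dir_deriv b \<phi> (x + t *\<^sub>R b))) (at t within UNIV)" for t
      using has_vector_derivative_along_line[OF test_function_differentiable[OF \<phi>]]
      by (simp add: has_vector_derivative_def)
    show "onorm (\<lambda>s. s *\<^sub>R dir_deriv b \<phi> (x + t *\<^sub>R b)) \<le> B" for t
    proof (rule onorm_le)
      fix s :: real
      show "norm (s *\<^sub>R dir_deriv b \<phi> (x + t *\<^sub>R b)) \<le> B * norm s"
        using mult_right_mono[OF B, of "\<bar>s\<bar>"] by (simp add: mult.commute)
    qed
  qed auto
  then show ?thesis by simp
qed

text \<open>Lebesgue measure is invariant under translations, so every difference quotient of \<open>\<phi>\<close> has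
  integral zero. The difference quotients are dominated by a multiple of the indicator of a
  ball.\<close>

lemma integral_dir_deriv_eq_0:
  assumes \<phi>: "test_function G \<phi>" and b: "b \<in> Basis"
  shows "(LINT x|lebesgue. dir_deriv b \<phi> x) = 0"
proof -
  obtain B where B: "\<And>x. cmod (dir_deriv b \<phi> x) \<le> B" "0 \<le> B"
    using test_function_bounded[OF test_function_dir_deriv[OF \<phi> b]] by blast
  have "bounded (closure {x. \<phi> x \<noteq> 0})" using \<phi> by (auto simp: test_function_def compact_imp_bounded)
  then obtain R where R: "\<And>x. x \<in> closure {x. \<phi> x \<noteq> 0} \<Longrightarrow> norm x \<le> R" by (auto simp: bounded_iff)
  then have far: "\<phi> x = 0" if "R < norm x" for x
    using that zero_outside_support[of x \<phi>] by (meson not_le)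
  define h where "h n = 1 / real (Suc n)" for n
  have h: "0 < h n" "h n \<le> 1" for n by (auto simp: h_def)
  have h0: "h \<longlonglongrightarrow> 0" unfolding h_def[abs_def] using LIMSEQ_inverse_real_of_nat by (simp add: divide_inverse)
  have [measurable]: "\<phi> \<in> borel_measurable borel"
    using test_function_continuous[OF \<phi>] by (rule borel_measurable_continuous_onI)
  have [measurable]: "dir_deriv b \<phi> \<in> borel_measurable borel"
    using test_function_continuous[OF test_function_dir_deriv[OF \<phi> b]] by (rule borel_measurable_continuous_onI)
  define q where "q n x = (1 / h n) *\<^sub>R (\<phi> (h n *\<^sub>R b + x) - \<phi> x)" for n x
  have i\<phi>: "integrable lborel \<phi>"
    using test_function_integrable[OF \<phi>] by (simp add: integrable_completion)
  have "(LINT x|lborel. q n x) = 0" for n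
  proof -
    have "(LINT x|lborel. \<phi> (h n *\<^sub>R b + x)) = (LINT x|distr lborel borel ((+) (h n *\<^sub>R b)). \<phi> x)"
      by (subst integral_distr) auto
    then have "(LINT x|lborel. \<phi> (h n *\<^sub>R b + x)) = integral\<^sup>L lborel \<phi>"
      by (simp add: lborel_distr_plus)
    moreover have "integrable lborel (\<lambda>x. \<phi> (h n *\<^sub>R b + x))"
      using i\<phi> integrable_distr[of "(+) (h n *\<^sub>R b)" lborel borel \<phi>] by (simp add: lborel_distr_plus)
    ultimately show ?thesis using i\<phi> by (simp add: q_def)
  qed
  moreover have "(\<lambda>n. LINT x|lborel. q n x) \<longlonglongrightarrow> (LINT x|lborel. dir_deriv b \<phi> x)"
  proof (rule integral_dominated_convergence[where w = "\<lambda>x. B * indicator (cball 0 (R + 1)) x"])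
    show "integrable lborel (\<lambda>x. B * indicator (cball (0::'a) (R + 1)) x)"
      using emeasure_bounded_finite[OF bounded_cball, of "0::'a" "R + 1"]
      by (intro integrable_mult_right integrable_real_indicator) auto
    show "AE x in lborel. (\<lambda>n. q n x) \<longlonglongrightarrow> dir_deriv b \<phi> x"
    proof (rule AE_I2)
      fix x
      have "((\<lambda>t. \<phi> (x + t *\<^sub>R b)) has_vector_derivative dir_deriv b \<phi> x) (at 0)"
        using has_vector_derivative_along_line[OF test_function_differentiable[OF \<phi>], where x = x and t = 0 and b = b] by simp
      from has_vector_derivative_quotient[OF this]
      have "((\<lambda>t. (1 / t) *\<^sub>R (\<phi> (t *\<^sub>R b + x) - \<phi> x)) \<longlongrightarrow> dir_deriv b \<phi> x) (at 0)"
        by (simp add: add.commute)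
      moreover have "filterlim h (at 0) sequentially"
        using h0 h(1) by (intro filterlim_atI always_eventually allI) (auto simp: less_imp_neq[symmetric])
      ultimately show "(\<lambda>n. q n x) \<longlonglongrightarrow> dir_deriv b \<phi> x"
        unfolding q_def by (rule filterlim_compose)
    qed
    show "AE x in lborel. norm (q n x) \<le> B * indicator (cball 0 (R + 1)) x" for n
    proof (rule AE_I2)
      fix x
      show "norm (q n x) \<le> B * indicator (cball 0 (R + 1)) x"
      proof (cases "norm x \<le> R + 1")
        case True
        have "cmod (\<phi> (x + h n *\<^sub>R b) - \<phi> x) \<le> B * h n"
          using difference_quotient_bound[OF \<phi> B(1), of x "h n"] h[of n] by simp
        then have "cmod (\<phi> (h n *\<^sub>R b + x) - \<phi> x) / h n \<le> B"
          using h[of n] by (simp add: add.commute divide_le_eq)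
        then show ?thesis
          using True h[of n] by (simp add: q_def[of n x])
      next
        case False
        have "norm x \<le> norm (h n *\<^sub>R b + x) + norm (h n *\<^sub>R b)"
          using norm_triangle_ineq4[of "h n *\<^sub>R b + x" "h n *\<^sub>R b"] by simp
        then have "R < norm (h n *\<^sub>R b + x)" "R < norm x" using False h[of n] b by auto
        then show ?thesis using far B(2) by (simp add: q_def)
      qed
    qed
    show "q n \<in> borel_measurable lborel" for n unfolding q_def[abs_def] by measurable
  qed measurable
  ultimately have "(LINT x|lborel. dir_deriv b \<phi> x) = 0"
    by (simp add: LIMSEQ_const_iff)
  then show ?thesis
    by (simp add: integral_completion)
qed

lemma test_function_times:
  assumes "test_function G \<phi>" "test_function G \<eta>"
  shows "test_function G (\<lambda>x. \<phi> x * \<eta> x)"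
  using test_function_mult[OF assms(2) test_function_C_k[OF assms(1)]] .

lemma test_function_integral_by_parts:
  assumes \<phi>: "test_function G \<phi>" and \<eta>: "test_function G \<eta>" and b: "b \<in> Basis"
  shows "(LINT x|lebesgue. \<phi> x * dir_deriv b \<eta> x) = - (LINT x|lebesgue. dir_deriv b \<phi> x * \<eta> x)"
proof -
  have "(LINT x|lebesgue. dir_deriv b (\<lambda>x. \<phi> x * \<eta> x) x) = 0"
    by (rule integral_dir_deriv_eq_0[OF test_function_times[OF \<phi> \<eta>] b])
  also have "dir_deriv b (\<lambda>x. \<phi> x * \<eta> x) x = \<phi> x * dir_deriv b \<eta> x + dir_deriv b \<phi> x * \<eta> x" for x
    by (rule dir_deriv_mult[OF test_function_differentiable[OF \<phi>] test_function_differentiable[OF \<eta>]])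
  then have "(LINT x|lebesgue. dir_deriv b (\<lambda>x. \<phi> x * \<eta> x) x)
      = (LINT x|lebesgue. \<phi> x * dir_deriv b \<eta> x) + (LINT x|lebesgue. dir_deriv b \<phi> x * \<eta> x)"
    using test_function_integrable[OF test_function_times[OF \<phi> test_function_dir_deriv[OF \<eta> b]]]
      test_function_integrable[OF test_function_times[OF test_function_dir_deriv[OF \<phi> b] \<eta>]]
    by (simp only: Bochner_Integration.integral_add)
  ultimately show ?thesis by (simp add: eq_neg_iff_add_eq_0)
qed

lemma integral_rep_L2_of_mult:
  assumes f: "square_integrable f" and [measurable]: "g \<in> borel_measurable lebesgue"
  shows "(LINT x|lebesgue. rep_L2 (L2_of f) x * g x) = (LINT x|lebesgue. f x * g x)"
proof -
  have [measurable]: "f \<in> borel_measurable lebesgue" "rep_L2 (L2_of f) \<in> borel_measurable lebesgue"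
    using f square_integrable_rep[of "L2_of f"] by (simp_all only: square_integrable_def)
  have "AE x in lebesgue. rep_L2 (L2_of f) x * g x = f x * g x"
    using rep_L2_of[OF f] by eventually_elim simp
  then show ?thesis by (intro integral_cong_AE) measurable
qed

lemma L2_of_in_L2_on:
  assumes "square_integrable f" "\<And>x. x \<notin> A \<Longrightarrow> f x = 0"
  shows "L2_of f \<in> L2_on A"
  unfolding L2_on_def mem_Collect_eq using rep_L2_of[OF assms(1)]
  by eventually_elim (use assms(2) in auto)

lemma L2_of_test_function_in_L2_on:
  assumes "test_function G \<phi>"
  shows "L2_of \<phi> \<in> L2_on G"
  using test_function_square_integrable[OF assms]
proof (rule L2_of_in_L2_on)
  have "closure {x. \<phi> x \<noteq> 0} \<subseteq> G" using assms by (simp only: test_function_def)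
  then show "\<phi> x = 0" if "x \<notin> G" for x
    using that by (intro zero_outside_support) (rule contra_subsetD)
qed

lemma weak_deriv_test_function:
  assumes \<phi>: "test_function G \<phi>" and b: "b \<in> Basis"
  shows "weak_deriv G b (L2_of \<phi>) (L2_of (dir_deriv b \<phi>))"
  unfolding weak_deriv_def
proof (intro allI impI)
  fix \<eta> assume \<eta>: "test_function G \<eta>"
  note d\<phi> = test_function_dir_deriv[OF \<phi> b] and d\<eta> = test_function_dir_deriv[OF \<eta> b]
  show "(LINT x|lebesgue. rep_L2 (L2_of \<phi>) x * dir_deriv b \<eta> x)
      = - (LINT x|lebesgue. rep_L2 (L2_of (dir_deriv b \<phi>)) x * \<eta> x)"
    unfolding integral_rep_L2_of_mult[OF test_function_square_integrable[OF \<phi>] test_function_measurable[OF d\<eta>]]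
      integral_rep_L2_of_mult[OF test_function_square_integrable[OF d\<phi>] test_function_measurable[OF \<eta>]]
    by (rule test_function_integral_by_parts[OF \<phi> \<eta> b])
qed

lemma test_function_in_H10:
  assumes \<phi>: "test_function G \<phi>"
  shows "L2_of \<phi> \<in> H10 G"
  unfolding H10_def mem_Collect_eq
proof (intro conjI exI[of _ "\<lambda>b. L2_of (dir_deriv b \<phi>)"] ballI allI impI)
  show "L2_of \<phi> \<in> L2_on G" by (rule L2_of_test_function_in_L2_on[OF \<phi>])
  fix b :: 'a assume b: "b \<in> Basis"
  show "L2_of (dir_deriv b \<phi>) \<in> L2_on G"
    by (rule L2_of_test_function_in_L2_on[OF test_function_dir_deriv[OF \<phi> b]])
  show "weak_deriv G b (L2_of \<phi>) (L2_of (dir_deriv b \<phi>))"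
    by (rule weak_deriv_test_function[OF \<phi> b])
next
  fix \<epsilon> :: real assume "\<epsilon> > 0"
  then show "\<exists>\<eta>. test_function G \<eta> \<and> sqrt ((norm (L2_of \<phi> - L2_of \<eta>))\<^sup>2
      + (\<Sum>b\<in>Basis. (norm (L2_of (dir_deriv b \<phi>) - L2_of (dir_deriv b \<eta>)))\<^sup>2)) < \<epsilon>"
    using \<phi> by (intro exI[of _ \<phi>]) simp
qed

text \<open>Test functions lie in the domain of the Dirichlet Laplacian: integrating by parts twice in
  each coordinate, their classical Laplacian is also the distributional one.\<close>

lemma dirichlet_laplacian_test_function:
  assumes \<phi>: "test_function G \<phi>"
  shows "dirichlet_laplacian G (L2_of \<phi>) (L2_of (laplace \<phi>))"
  unfolding dirichlet_laplacian_def
proof (intro conjI allI impI)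
  note \<Delta>\<phi> = test_function_laplace[OF \<phi>]
  show "L2_of \<phi> \<in> H10 G" by (rule test_function_in_H10[OF \<phi>])
  show "L2_of (laplace \<phi>) \<in> L2_on G" by (rule L2_of_test_function_in_L2_on[OF \<Delta>\<phi>])
  fix \<eta> assume \<eta>: "test_function G \<eta>"
  have dd: "test_function G (dir_deriv b (dir_deriv b \<phi>))" "test_function G (dir_deriv b (dir_deriv b \<eta>))"
    if "b \<in> Basis" for b
    by (intro test_function_dir_deriv that \<phi> \<eta>)+
  have "(LINT x|lebesgue. \<phi> x * laplace \<eta> x) = (LINT x|lebesgue. (\<Sum>b\<in>Basis. \<phi> x * dir_deriv b (dir_deriv b \<eta>) x))"
    by (simp add: laplace_def sum_distrib_left)
  also have "\<dots> = (\<Sum>b\<in>Basis. (LINT x|lebesgue. \<phi> x * dir_deriv b (dir_deriv b \<eta>) x))"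
    by (rule Bochner_Integration.integral_sum) (rule test_function_integrable[OF test_function_times[OF \<phi> dd(2)]])
  also have "\<dots> = (\<Sum>b\<in>Basis. (LINT x|lebesgue. dir_deriv b (dir_deriv b \<phi>) x * \<eta> x))"
  proof (rule sum.cong[OF refl])
    fix b :: 'a assume b: "b \<in> Basis"
    show "(LINT x|lebesgue. \<phi> x * dir_deriv b (dir_deriv b \<eta>) x) = (LINT x|lebesgue. dir_deriv b (dir_deriv b \<phi>) x * \<eta> x)"
      using test_function_integral_by_parts[OF \<phi> test_function_dir_deriv[OF \<eta> b] b]
        test_function_integral_by_parts[OF test_function_dir_deriv[OF \<phi> b] \<eta> b] by simp
  qed
  also have "\<dots> = (LINT x|lebesgue. (\<Sum>b\<in>Basis. dir_deriv b (dir_deriv b \<phi>) x * \<eta> x))"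
    by (rule Bochner_Integration.integral_sum[symmetric]) (rule test_function_integrable[OF test_function_times[OF dd(1) \<eta>]])
  also have "\<dots> = (LINT x|lebesgue. laplace \<phi> x * \<eta> x)"
    by (simp add: laplace_def sum_distrib_right)
  finally show "(LINT x|lebesgue. rep_L2 (L2_of \<phi>) x * laplace \<eta> x) = (LINT x|lebesgue. rep_L2 (L2_of (laplace \<phi>)) x * \<eta> x)"
    unfolding integral_rep_L2_of_mult[OF test_function_square_integrable[OF \<phi>] test_function_measurable[OF test_function_laplace[OF \<eta>]]]
      integral_rep_L2_of_mult[OF test_function_square_integrable[OF \<Delta>\<phi>] test_function_measurable[OF \<eta>]] .
qed

section \<open>High frequency test functions\<close>

definition plane_wave :: "real \<Rightarrow> 'a::euclidean_space \<Rightarrow> 'a \<Rightarrow> complex" where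
  "plane_wave k b x = exp (\<i> * of_real (k * (x \<bullet> b)))"

lemma norm_plane_wave [simp]: "cmod (plane_wave k b x) = 1"
  unfolding plane_wave_def by (rule norm_exp_i_times)

lemma plane_wave_has_derivative:
  "(plane_wave k b has_derivative (\<lambda>c. \<i> * of_real (k * (c \<bullet> b)) * plane_wave k b x)) (at x)"
proof -
  have "((\<lambda>x. \<i> * of_real (k * (x \<bullet> b))) has_derivative (\<lambda>c. \<i> * of_real (k * (c \<bullet> b)))) (at x)"
    by (auto intro!: derivative_eq_intros)
  then have "((\<lambda>x. exp (\<i> * of_real (k * (x \<bullet> b)))) has_derivative
      (\<lambda>c. exp (\<i> * of_real (k * (x \<bullet> b))) * (\<i> * of_real (k * (c \<bullet> b))))) (at x)"
    by (rule has_derivative_compose) (simp add: has_field_derivative_imp_has_derivative)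
  then show ?thesis by (simp add: plane_wave_def[abs_def] mult.commute)
qed

lemma plane_wave_differentiable: "plane_wave k b differentiable (at x)"
  using plane_wave_has_derivative by (rule differentiableI)

lemma dir_deriv_plane_wave:
  "dir_deriv c (plane_wave k b) = (\<lambda>x. \<i> * of_real (k * (c \<bullet> b)) * plane_wave k b x)"
  by (rule ext) (rule dir_deriv_at[OF plane_wave_has_derivative])

lemma C_k_plane_wave: "C_k m (plane_wave k b)"
proof (induction m)
  case 0
  have "isCont (plane_wave k b) x" for x
    by (rule differentiable_imp_continuous_within[OF plane_wave_differentiable])
  then show ?case by (simp add: continuous_on_eq_continuous_at)
next
  case (Suc m)
  then show ?case
    by (auto simp: dir_deriv_plane_wave plane_wave_differentiable intro!: C_k_mult C_k_const simp del: of_real_mult)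
qed

lemma laplace_plane_wave_mult:
  assumes \<phi>: "test_function G \<phi>" and b: "b \<in> Basis"
  shows "laplace (\<lambda>x. plane_wave k b x * \<phi> x) x
      = plane_wave k b x * (laplace \<phi> x + (2 * \<i> * of_real k * dir_deriv b \<phi> x - of_real (k\<^sup>2) * \<phi> x))"
proof -
  let ?E = "plane_wave k b"
  define \<kappa> where "\<kappa> c = \<i> * of_real (k * (c \<bullet> b))" for c :: 'a
  have mult: "dir_deriv c (\<lambda>x. ?E x * f x) = (\<lambda>x. ?E x * (\<kappa> c * f x + dir_deriv c f x))"
    if "\<And>x. f differentiable (at x)" for c f
  proof (rule ext)
    fix x
    show "dir_deriv c (\<lambda>x. ?E x * f x) x = ?E x * (\<kappa> c * f x + dir_deriv c f x)"
      unfolding dir_deriv_mult[OF plane_wave_differentiable that] dir_deriv_plane_wave \<kappa>_def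
      by (simp only: distrib_left mult_ac add_ac)
  qed
  have d: "\<phi> differentiable (at x)" "dir_deriv c \<phi> differentiable (at x)" if "c \<in> Basis" for c x
    using test_function_differentiable[OF \<phi>] test_function_differentiable[OF test_function_dir_deriv[OF \<phi> that]] .
  have "dir_deriv c (dir_deriv c (\<lambda>x. ?E x * \<phi> x)) x
      = ?E x * (dir_deriv c (dir_deriv c \<phi>) x + (2 * \<kappa> c * dir_deriv c \<phi> x + \<kappa> c * \<kappa> c * \<phi> x))" if c: "c \<in> Basis" for c
  proof -
    have cd: "(\<lambda>x. \<kappa> c * \<phi> x) differentiable (at x)" for x
      by (intro differentiable_mult differentiable_const d(1)[OF c])
    have "dir_deriv c (\<lambda>x. \<kappa> c * \<phi> x) x = \<kappa> c * dir_deriv c \<phi> x"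
      using has_derivative_mult_right[OF has_dir_deriv[OF d(1)[OF c, of x]], of "\<kappa> c"] by (rule dir_deriv_at)
    then have "dir_deriv c (\<lambda>x. \<kappa> c * \<phi> x + dir_deriv c \<phi> x) x = \<kappa> c * dir_deriv c \<phi> x + dir_deriv c (dir_deriv c \<phi>) x"
      using dir_deriv_add[OF cd d(2)[OF c], of c x] by simp
    moreover have "(\<lambda>x. \<kappa> c * \<phi> x + dir_deriv c \<phi> x) differentiable (at x)" for x
      by (intro differentiable_add cd d(2)[OF c])
    ultimately have "dir_deriv c (dir_deriv c (\<lambda>x. ?E x * \<phi> x)) x
        = ?E x * (\<kappa> c * (\<kappa> c * \<phi> x + dir_deriv c \<phi> x) + (\<kappa> c * dir_deriv c \<phi> x + dir_deriv c (dir_deriv c \<phi>) x))"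
      by (simp only: mult[OF d(1)[OF c]] mult)
    then show ?thesis by (simp add: algebra_simps)
  qed
  then have "laplace (\<lambda>x. ?E x * \<phi> x) x
      = (\<Sum>c\<in>Basis. ?E x * (dir_deriv c (dir_deriv c \<phi>) x + (2 * \<kappa> c * dir_deriv c \<phi> x + \<kappa> c * \<kappa> c * \<phi> x)))"
    by (simp add: laplace_def)
  also have "\<dots> = ?E x * (laplace \<phi> x + (\<Sum>c\<in>Basis. 2 * \<kappa> c * dir_deriv c \<phi> x + \<kappa> c * \<kappa> c * \<phi> x))"
    by (simp only: sum_distrib_left[symmetric] sum.distrib laplace_def)
  also have "(\<Sum>c\<in>Basis. 2 * \<kappa> c * dir_deriv c \<phi> x + \<kappa> c * \<kappa> c * \<phi> x)
      = (\<Sum>c\<in>Basis. if c = b then 2 * \<i> * of_real k * dir_deriv b \<phi> x - of_real (k\<^sup>2) * \<phi> x else 0)"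
    using b by (intro sum.cong) (auto simp: \<kappa>_def inner_Basis power2_eq_square mult_ac)
  also have "\<dots> = 2 * \<i> * of_real k * dir_deriv b \<phi> x - of_real (k\<^sup>2) * \<phi> x"
    using b by (subst sum.delta) auto
  finally show ?thesis .
qed

lemma norm_L2_of_mult:
  assumes "square_integrable f" "square_integrable (\<lambda>x. c x * f x)" "\<And>x. cmod (c x) = r" "0 \<le> r"
  shows "norm (L2_of (\<lambda>x. c x * f x)) = r * norm (L2_of f)"
proof -
  have "(norm (L2_of (\<lambda>x. c x * f x)))\<^sup>2 = (r * norm (L2_of f))\<^sup>2"
    by (simp add: norm_L2_of[OF assms(2)] norm_L2_of[OF assms(1)] norm_mult assms(3) power_mult_distrib)
  then show ?thesis using assms(4) by (simp add: power2_eq_iff_nonneg)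
qed

lemma norm_L2_of_scale:
  assumes "square_integrable f"
  shows "norm (L2_of (\<lambda>x. c * f x)) = cmod c * norm (L2_of f)"
  using assms square_integrable_scaleC[OF assms, of c] by (rule norm_L2_of_mult) simp_all

text \<open>For the product of \<open>\<phi>\<close> with a plane wave, the Laplacian contains, up to the phase factor,
  the term \<open>- k^2 * \<phi>\<close>, while the other terms grow at most linearly in \<open>k\<close>.\<close>

lemma laplace_unbounded:
  fixes \<phi> :: "'a::euclidean_space \<Rightarrow> complex"
  assumes \<phi>: "test_function G \<phi>" and nz: "L2_of \<phi> \<noteq> 0" and K: "0 \<le> K"
  shows "\<exists>\<eta>. test_function G \<eta> \<and> L2_of \<eta> \<noteq> 0 \<and> K * norm (L2_of \<eta>) \<le> norm (L2_of (laplace \<eta>))"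
proof -
  obtain b :: 'a where b: "b \<in> Basis" using nonempty_Basis by blast
  define N0 N1 N2 where "N0 = norm (L2_of \<phi>)" and "N1 = norm (L2_of (dir_deriv b \<phi>))"
    and "N2 = norm (L2_of (laplace \<phi>))"
  have N: "0 < N0" "0 \<le> N1" "0 \<le> N2" using nz by (auto simp: N0_def N1_def N2_def)
  \<comment> \<open>Large enough that \<open>k\<^sup>2 * N0\<close> dominates \<open>K * N0\<close> together with the terms \<open>2 * k * N1\<close> and \<open>N2\<close> of lower order in \<open>k\<close>.\<close>
  define k where "k = 1 + K + (2 * N1 + N2) / N0"
  have k: "1 \<le> k" "K * N0 + 2 * N1 + N2 \<le> k * N0"
    using N K by (auto simp: k_def field_simps)
  have key: "K * N0 + (2 * k * N1 + N2) \<le> k\<^sup>2 * N0"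
  proof -
    have "K * N0 + (2 * k * N1 + N2) \<le> k * (K * N0 + 2 * N1 + N2)"
      using mult_right_mono[OF k(1), of "K * N0"] mult_right_mono[OF k(1), of N2] N K
      by (simp add: algebra_simps)
    also have "\<dots> \<le> k * (k * N0)" using k by (intro mult_left_mono) auto
    finally show ?thesis by (simp add: power2_eq_square mult.assoc)
  qed
  define \<eta> where "\<eta> x = plane_wave k b x * \<phi> x" for x
  have \<eta>: "test_function G \<eta>"
    unfolding \<eta>_def[abs_def] by (rule test_function_mult[OF \<phi> C_k_plane_wave])
  note si0 = test_function_square_integrable[OF \<phi>]
    and si1 = test_function_square_integrable[OF test_function_dir_deriv[OF \<phi> b]]
    and si2 = test_function_square_integrable[OF test_function_laplace[OF \<phi>]]
  define f1 where "f1 x = 2 * \<i> * of_real k * dir_deriv b \<phi> x" for x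
  define f2 where "f2 x = of_real (k\<^sup>2) * \<phi> x" for x
  have sf1: "square_integrable f1" and sf2: "square_integrable f2"
    unfolding f1_def[abs_def] f2_def[abs_def] by (intro square_integrable_scaleC si0 si1)+
  have nf1: "norm (L2_of f1) = 2 * k * N1"
    unfolding f1_def[abs_def] norm_L2_of_scale[OF si1] N1_def using k by (simp add: norm_mult)
  have nf2: "norm (L2_of f2) = k\<^sup>2 * N0"
    unfolding f2_def[abs_def] norm_L2_of_scale[OF si0] N0_def by (simp add: norm_power)
  have n\<eta>: "norm (L2_of \<eta>) = N0"
    using norm_L2_of_mult[OF si0, of "plane_wave k b" 1] test_function_square_integrable[OF \<eta>]
    by (simp add: \<eta>_def[abs_def] N0_def)
  have lap: "laplace \<eta> = (\<lambda>x. plane_wave k b x * (laplace \<phi> x + (f1 x - f2 x)))"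
    unfolding \<eta>_def[abs_def] f1_def f2_def by (rule ext) (rule laplace_plane_wave_mult[OF \<phi> b])
  have sd: "square_integrable (\<lambda>x. f1 x - f2 x)" by (rule square_integrable_diff[OF sf1 sf2])
  have "norm (L2_of (laplace \<eta>)) = norm (L2_of (\<lambda>x. laplace \<phi> x + (f1 x - f2 x)))"
    using norm_L2_of_mult[OF square_integrable_add[OF si2 sd], of "plane_wave k b" 1]
      test_function_square_integrable[OF test_function_laplace[OF \<eta>]] by (simp add: lap)
  also have "\<dots> = norm (L2_of (laplace \<phi>) + (L2_of f1 - L2_of f2))"
    by (simp only: L2_of_add[OF si2 sd] L2_of_diff[OF sf1 sf2])
  also have "\<dots> \<ge> norm (L2_of f2) - norm (L2_of f1) - N2"
    using norm_triangle_ineq2[of "L2_of f2" "L2_of f1"]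
      norm_triangle_ineq2[of "L2_of f2 - L2_of f1" "L2_of (laplace \<phi>)"]
      norm_minus_commute[of "L2_of f2" "L2_of f1 + L2_of (laplace \<phi>)"]
    by (simp add: N2_def algebra_simps)
  finally have "K * N0 \<le> norm (L2_of (laplace \<eta>))" using key by (simp add: nf1 nf2)
  moreover have "L2_of \<eta> \<noteq> 0" using n\<eta> N by auto
  ultimately show ?thesis using \<eta> n\<eta> by auto
qed

section \<open>Restriction to a subset of the domain\<close>

lemma rep_L2_measurable [measurable]: "rep_L2 f \<in> borel_measurable lebesgue"
  using square_integrable_rep[of f] by (simp only: square_integrable_def)

lemma restrict_L2_square_integrable:
  assumes "A \<in> sets lebesgue"
  shows "square_integrable (\<lambda>x. indicator A x * rep_L2 f x)"
proof -
  have "integrable lebesgue (\<lambda>x. (cmod (rep_L2 f x))\<^sup>2)"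
    using square_integrable_rep[of f] by (simp only: square_integrable_def)
  then have "integrable lebesgue (\<lambda>x. (cmod (indicator A x * rep_L2 f x))\<^sup>2)"
    by (rule Bochner_Integration.integrable_bound) (use assms in \<open>auto simp: indicator_def\<close>)
  then show ?thesis using assms by (simp add: square_integrable_def)
qed

lemma rep_restrict_L2:
  assumes "A \<in> sets lebesgue"
  shows "AE x in lebesgue. rep_L2 (restrict_L2 A f) x = indicator A x * rep_L2 f x"
  unfolding restrict_L2_def by (rule rep_L2_of[OF restrict_L2_square_integrable[OF assms]])

lemma inner_L2_AE:
  assumes "AE x in lebesgue. rep_L2 f x \<bullet> rep_L2 g x = h x" and [measurable]: "h \<in> borel_measurable lebesgue"
  shows "f \<bullet> g = (LINT x|lebesgue. h x)"
  unfolding inner_L2.rep_eq using assms by (intro integral_cong_AE) measurable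

lemma rep_L2_add: "AE x in lebesgue. rep_L2 (f + g) x = rep_L2 f x + rep_L2 g x"
  using rep_L2_of[OF square_integrable_add[OF square_integrable_rep square_integrable_rep], of f g]
  by (simp add: L2_of_add)

lemma L2_of_scaleR: "square_integrable f \<Longrightarrow> L2_of (\<lambda>x. of_real r * f x) = r *\<^sub>R L2_of f"
  by (simp add: L2_of_def square_integrable_scaleC scaleR_L2.abs_eq L2_rel_def)

lemma rep_L2_scaleR: "AE x in lebesgue. rep_L2 (r *\<^sub>R f) x = of_real r * rep_L2 f x"
  using rep_L2_of[OF square_integrable_scaleC[OF square_integrable_rep], of "of_real r" f]
  by (simp add: L2_of_scaleR)

lemma L2_on_iff_restrict_L2:
  assumes "A \<in> sets lebesgue"
  shows "f \<in> L2_on A \<longleftrightarrow> restrict_L2 A f = f"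
proof
  assume "f \<in> L2_on A"
  then have "AE x in lebesgue. x \<notin> A \<longrightarrow> rep_L2 f x = 0" by (simp add: L2_on_def)
  with rep_restrict_L2[OF assms, of f]
  have "AE x in lebesgue. rep_L2 (restrict_L2 A f) x = rep_L2 f x"
    by eventually_elim (auto simp: indicator_def)
  then show "restrict_L2 A f = f" by (simp add: L2_eq_iff)
next
  assume "restrict_L2 A f = f"
  with rep_restrict_L2[OF assms, of f]
  have "AE x in lebesgue. rep_L2 f x = indicator A x * rep_L2 f x" by simp
  then have "AE x in lebesgue. x \<notin> A \<longrightarrow> rep_L2 f x = 0"
    by eventually_elim (auto simp: indicator_def)
  then show "f \<in> L2_on A" by (simp add: L2_on_def)
qed

lemma restrict_L2_in_L2_on:
  assumes "A \<in> sets lebesgue"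
  shows "restrict_L2 A f \<in> L2_on A"
proof -
  have "AE x in lebesgue. x \<notin> A \<longrightarrow> rep_L2 (restrict_L2 A f) x = 0"
    using rep_restrict_L2[OF assms, of f] by eventually_elim (auto simp: indicator_def)
  then show ?thesis by (simp add: L2_on_def)
qed

lemma L2_on_mono: "A \<subseteq> B \<Longrightarrow> L2_on A \<subseteq> L2_on B"
  unfolding L2_on_def by (auto elim: eventually_mono)

text \<open>Restriction is the orthogonal projection onto the functions supported in \<open>A\<close>.\<close>

lemma inner_restrict_L2:
  assumes "A \<in> sets lebesgue" "g \<in> L2_on A"
  shows "restrict_L2 A f \<bullet> g = f \<bullet> g"
proof -
  have "AE x in lebesgue. x \<notin> A \<longrightarrow> rep_L2 g x = 0" using assms(2) by (simp add: L2_on_def)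
  with rep_restrict_L2[OF assms(1), of f]
  have "AE x in lebesgue. rep_L2 (restrict_L2 A f) x \<bullet> rep_L2 g x = rep_L2 f x \<bullet> rep_L2 g x"
    by eventually_elim (auto simp: indicator_def)
  then show ?thesis by (simp add: inner_L2_AE inner_L2.rep_eq[of f g])
qed

lemma linear_restrict_L2:
  assumes A: "A \<in> sets lebesgue"
  shows "linear (restrict_L2 A)"
proof (rule linearI)
  fix f g :: "'a L2" and r :: real
  have "AE x in lebesgue. rep_L2 (restrict_L2 A (f + g)) x = rep_L2 (restrict_L2 A f + restrict_L2 A g) x"
    using rep_restrict_L2[OF A, of "f + g"] rep_restrict_L2[OF A, of f] rep_restrict_L2[OF A, of g]
      rep_L2_add[of f g] rep_L2_add[of "restrict_L2 A f" "restrict_L2 A g"]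
    by eventually_elim (simp add: distrib_left)
  then show "restrict_L2 A (f + g) = restrict_L2 A f + restrict_L2 A g" by (simp add: L2_eq_iff)
  have "AE x in lebesgue. rep_L2 (restrict_L2 A (r *\<^sub>R f)) x = rep_L2 (r *\<^sub>R restrict_L2 A f) x"
    using rep_restrict_L2[OF A, of "r *\<^sub>R f"] rep_restrict_L2[OF A, of f]
      rep_L2_scaleR[of r f] rep_L2_scaleR[of r "restrict_L2 A f"]
    by eventually_elim simp
  then show "restrict_L2 A (r *\<^sub>R f) = r *\<^sub>R restrict_L2 A f" by (simp add: L2_eq_iff)
qed

lemma norm_restrict_L2_le:
  assumes A: "A \<in> sets lebesgue"
  shows "norm (restrict_L2 A f) \<le> norm f"
proof -
  have "restrict_L2 A f \<bullet> restrict_L2 A f = f \<bullet> restrict_L2 A f"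
    by (rule inner_restrict_L2[OF A restrict_L2_in_L2_on[OF A]])
  then have "norm (restrict_L2 A f) * norm (restrict_L2 A f) \<le> norm f * norm (restrict_L2 A f)"
    using norm_cauchy_schwarz[of f "restrict_L2 A f"] by (simp add: power2_norm_eq_inner[symmetric] power2_eq_square)
  then show ?thesis by (cases "restrict_L2 A f = 0") auto
qed

section \<open>The Schroedinger group\<close>

lemma norm_scaleC_L2: "norm (scaleC_L2 c f) = cmod c * norm f"
proof -
  have "(norm (scaleC_L2 c f))\<^sup>2 = (cmod c * norm (L2_of (rep_L2 f)))\<^sup>2"
    using norm_L2_of[OF square_integrable_scaleC[OF square_integrable_rep], of c f]
      norm_L2_of[OF square_integrable_rep, of f]
    by (simp add: scaleC_L2_def norm_mult power_mult_distrib del: L2_of_rep)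
  then show ?thesis by (simp add: power2_eq_iff_nonneg)
qed

lemma scaleC_L2_of_real: "scaleC_L2 (of_real r) f = r *\<^sub>R f"
  by (simp add: scaleC_L2_def L2_of_scaleR)

text \<open>The group is only determined on the subspace of functions supported in \<open>G\<close>. Acting as the
  identity on the orthogonal complement makes it a group of isometries of the whole Hilbert
  space.\<close>

definition extend_group :: "'a::euclidean_space set \<Rightarrow> (real \<Rightarrow> 'a L2 \<Rightarrow> 'a L2) \<Rightarrow> real \<Rightarrow> 'a L2 \<Rightarrow> 'a L2" where
  "extend_group G S t f = S t (restrict_L2 G f) + (f - restrict_L2 G f)"

lemma extend_group_eq:
  assumes "G \<in> sets lebesgue" "f \<in> L2_on G"
  shows "extend_group G S t f = S t f"
  using assms by (simp add: extend_group_def L2_on_iff_restrict_L2)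

text \<open>The two parts of \<open>extend_group G S t f\<close> stay in orthogonal subspaces, so its norm is
  preserved by Pythagoras' theorem.\<close>

lemma isometry_group_extend_group:
  fixes G :: "'a::euclidean_space set"
  assumes G: "G \<in> sets lebesgue" and S: "unitary_group_on (L2_on G) S"
  shows "isometry_group (extend_group G S)"
proof -
  define P where "P = restrict_L2 G"
  have P: "P f \<in> L2_on G" for f unfolding P_def by (rule restrict_L2_in_L2_on[OF G])
  have P_id: "P f = f" if "f \<in> L2_on G" for f
    using that G by (simp add: P_def L2_on_iff_restrict_L2)
  have P_lin: "linear P" unfolding P_def by (rule linear_restrict_L2[OF G])
  have P_inner: "g \<bullet> (f - P f) = 0" if "g \<in> L2_on G" for f g
    using inner_restrict_L2[OF G that, of f] by (simp add: P_def inner_diff_right inner_commute)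
  have S_in: "S t f \<in> L2_on G" if "f \<in> L2_on G" for t f
    using S that unfolding unitary_group_on_def bij_betw_def by blast
  have S_add: "S t (f + g) = S t f + S t g" if "f \<in> L2_on G" "g \<in> L2_on G" for t f g
    using S that unfolding unitary_group_on_def by blast
  have S_scale: "S t (r *\<^sub>R f) = r *\<^sub>R S t f" if "f \<in> L2_on G" for t r f
    using S that unfolding unitary_group_on_def by (metis scaleC_L2_of_real)
  have S_norm: "norm (S t f) = norm f" if "f \<in> L2_on G" for t f
    using S that unfolding unitary_group_on_def by blast
  have S_zero: "S 0 f = f" if "f \<in> L2_on G" for f
    using S that unfolding unitary_group_on_def by blast
  have S_group: "S (s + t) f = S s (S t f)" if "f \<in> L2_on G" for s t f
    using S that unfolding unitary_group_on_def by blast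
  have S_cont: "continuous_on UNIV (\<lambda>t. S t f)" if "f \<in> L2_on G" for f
    using S that unfolding unitary_group_on_def by blast
  have pythagoras: "norm (g + (f - P f)) = sqrt ((norm g)\<^sup>2 + (norm (f - P f))\<^sup>2)" if "g \<in> L2_on G" for f g
    by (rule real_sqrt_unique[symmetric])
      (simp_all add: power2_norm_eq_inner inner_add_left inner_add_right P_inner[OF that] inner_commute[of "f - P f" g])
  show ?thesis
    unfolding extend_group_def[abs_def] P_def[symmetric]
  proof (rule isometry_group.intro)
    fix s t :: real and f :: "'a L2"
    show "linear (\<lambda>f. S t (P f) + (f - P f))"
      by (rule linearI)
        (simp_all add: linear_add[OF P_lin] linear_scale[OF P_lin] S_add S_scale P scaleR_add_right scaleR_diff_right)
    show "S 0 (P f) + (f - P f) = f" by (simp add: S_zero P)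
    have "P (S t (P f) + (f - P f)) = S t (P f)"
      by (simp add: linear_add[OF P_lin] linear_diff[OF P_lin] P_id P S_in)
    then show "S (s + t) (P f) + (f - P f)
        = S s (P (S t (P f) + (f - P f))) + (S t (P f) + (f - P f) - P (S t (P f) + (f - P f)))"
      by (simp add: S_group P)
    show "norm (S t (P f) + (f - P f)) = norm f"
      using pythagoras[OF S_in[OF P], of t f f] pythagoras[OF P, of f f] by (simp add: S_norm P)
    show "continuous_on UNIV (\<lambda>t. S t (P f) + (f - P f))"
      by (intro continuous_on_add S_cont P continuous_on_const)
  qed
qed

lemma group_generator_iff_generates:
  assumes G: "G \<in> sets lebesgue" and S: "unitary_group_on (L2_on G) S"
  shows "group_generator (L2_on G) S f g \<longleftrightarrow>
    f \<in> L2_on G \<and> g \<in> L2_on G \<and> isometry_group.generates (extend_group G S) f g"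
proof -
  interpret isometry_group "extend_group G S" by (rule isometry_group_extend_group[OF G S])
  show ?thesis
    by (auto simp: group_generator_def generates_def extend_group_eq[OF G])
qed

text \<open>If \<open>0\<close> were the only test function, then \<open>H10 G\<close>, and with it the domain of the generator,
  would be trivial. But the domain contains the integrals of orbits, and not all of them
  vanish.\<close>

lemma exists_nonzero_test_function:
  fixes G :: "'a::euclidean_space set"
  assumes G: "G \<in> sets lebesgue" and S: "schroedinger_group G S"
    and f: "f \<in> L2_on G" "f \<noteq> 0"
  shows "\<exists>\<phi>. test_function G \<phi> \<and> L2_of \<phi> \<noteq> 0"
proof -
  have unitary: "unitary_group_on (L2_on G) S" using S by (simp only: schroedinger_group_def)
  interpret isometry_group "extend_group G S" by (rule isometry_group_extend_group[OF G unitary])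
  let ?U = "extend_group G S"
  obtain a where a: "0 < a" and nz: "integral {0..a} (\<lambda>t. ?U t f) \<noteq> 0"
    using orbit_integral_nonzero[OF f(2)] by blast
  define x where "x = integral {0..a} (\<lambda>t. ?U t f)"
  have gen: "generates x (?U a f - f)" unfolding x_def by (rule generates_orbit_integral[OF a])
  have U_in: "?U t f \<in> L2_on G" for t
    using unitary f(1) unfolding unitary_group_on_def bij_betw_def extend_group_eq[OF G f(1)] by blast
  have P_lin: "bounded_linear (restrict_L2 G)"
    using linear_restrict_L2[OF G] norm_restrict_L2_le[OF G]
    by (intro bounded_linear_intro[where K = 1]) (auto simp: linear_add linear_scale)
  have "(\<lambda>t. ?U t f) integrable_on {0..a}"
    by (rule integrable_continuous_real) (rule continuous_on_subset[OF cont], simp)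
  from integral_linear[OF this P_lin] have "restrict_L2 G x = x"
    using U_in G by (simp add: x_def o_def L2_on_iff_restrict_L2)
  then have x: "x \<in> L2_on G" using G by (simp add: L2_on_iff_restrict_L2)
  have "restrict_L2 G (?U a f - f) = ?U a f - f"
    using U_in[of a] f(1) G by (simp add: linear_diff[OF linear_restrict_L2[OF G]] L2_on_iff_restrict_L2)
  then have "?U a f - f \<in> L2_on G" using G by (simp add: L2_on_iff_restrict_L2)
  with gen x have "group_generator (L2_on G) S x (?U a f - f)"
    by (simp add: group_generator_iff_generates[OF G unitary])
  then obtain h where "dirichlet_laplacian G x h"
    using S unfolding schroedinger_group_def by blast
  then have "x \<in> H10 G" by (simp only: dirichlet_laplacian_def)
  moreover have "0 < norm x" using nz by (simp add: x_def)
  ultimately obtain g \<phi> where \<phi>: "test_function G \<phi>" and close: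
    "sqrt ((norm (x - L2_of \<phi>))\<^sup>2 + (\<Sum>b\<in>Basis. (norm (g b - L2_of (dir_deriv b \<phi>)))\<^sup>2)) < norm x"
    unfolding H10_def by blast
  have "norm (x - L2_of \<phi>) \<le> sqrt ((norm (x - L2_of \<phi>))\<^sup>2 + (\<Sum>b\<in>Basis. (norm (g b - L2_of (dir_deriv b \<phi>)))\<^sup>2))"
    by (rule real_le_rsqrt) (simp add: sum_nonneg)
  with close have "L2_of \<phi> \<noteq> 0" by auto
  with \<phi> show ?thesis by blast
qed

text \<open>The vectors \<open>\<psi> n\<close> are high frequency test functions, rescaled so that their images under
  \<open>\<i> \<Delta>\<close> have norm \<open>1\<close>.\<close>

lemma generator_unbounded:
  fixes G :: "'a::euclidean_space set"
  assumes G: "G \<in> sets lebesgue" and S: "schroedinger_group G S"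
    and f: "f \<in> L2_on G" "f \<noteq> 0"
  obtains \<psi> \<phi> :: "nat \<Rightarrow> 'a L2" where
    "\<And>n. isometry_group.generates (extend_group G S) (\<psi> n) (\<phi> n)"
    "\<And>n. \<phi> n \<in> L2_on G" "\<And>n. norm (\<phi> n) = 1" "\<psi> \<longlonglongrightarrow> 0"
proof -
  have unitary: "unitary_group_on (L2_on G) S" using S by (simp only: schroedinger_group_def)
  interpret isometry_group "extend_group G S" by (rule isometry_group_extend_group[OF G unitary])
  obtain \<phi>0 where \<phi>0: "test_function G \<phi>0" "L2_of \<phi>0 \<noteq> 0"
    using exists_nonzero_test_function[OF G S f] by blast
  have "\<exists>\<eta>. test_function G \<eta> \<and> L2_of \<eta> \<noteq> 0 \<and> real (Suc n) * norm (L2_of \<eta>) \<le> norm (L2_of (laplace \<eta>))" for n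
    using laplace_unbounded[OF \<phi>0, of "real (Suc n)"] by simp
  then obtain \<eta> where \<eta>: "\<And>n. test_function G (\<eta> n)" "\<And>n. L2_of (\<eta> n) \<noteq> 0"
    and grow: "\<And>n. real (Suc n) * norm (L2_of (\<eta> n)) \<le> norm (L2_of (laplace (\<eta> n)))"
    by metis
  define r where "r n = 1 / norm (L2_of (laplace (\<eta> n)))" for n
  have pos: "0 < norm (L2_of (laplace (\<eta> n)))" for n
    using \<eta>(2)[of n] by (intro less_le_trans[OF _ grow]) simp
  define \<psi> where "\<psi> n = r n *\<^sub>R L2_of (\<eta> n)" for n
  define \<phi> where "\<phi> n = r n *\<^sub>R scaleC_L2 \<i> (L2_of (laplace (\<eta> n)))" for n
  have "group_generator (L2_on G) S (L2_of (\<eta> n)) (scaleC_L2 \<i> (L2_of (laplace (\<eta> n))))" for n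
    using S dirichlet_laplacian_test_function[OF \<eta>(1)] unfolding schroedinger_group_def by blast
  then have gen: "generates (L2_of (\<eta> n)) (scaleC_L2 \<i> (L2_of (laplace (\<eta> n))))"
    and mem: "scaleC_L2 \<i> (L2_of (laplace (\<eta> n))) \<in> L2_on G" for n
    by (simp_all add: group_generator_iff_generates[OF G unitary])
  show ?thesis
  proof
    show "generates (\<psi> n) (\<phi> n)" for n
      unfolding \<psi>_def \<phi>_def by (rule generates_scaleR[OF gen])
    show "\<phi> n \<in> L2_on G" for n
      using mem[of n] G by (simp add: \<phi>_def L2_on_iff_restrict_L2 linear_scale[OF linear_restrict_L2[OF G]])
    show "norm (\<phi> n) = 1" for n
      using pos[of n] by (simp add: \<phi>_def r_def norm_scaleC_L2)
    show "\<psi> \<longlonglongrightarrow> 0"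
    proof (rule Lim_null_comparison)
      show "\<forall>\<^sub>F n in sequentially. norm (\<psi> n) \<le> inverse (real (Suc n))"
      proof (rule always_eventually, rule allI)
        fix n
        show "norm (\<psi> n) \<le> inverse (real (Suc n))"
          using grow[of n] pos[of n] by (simp add: \<psi>_def r_def field_simps)
      qed
      show "(\<lambda>n. inverse (real (Suc n))) \<longlonglongrightarrow> 0" by (rule LIMSEQ_inverse_real_of_nat)
    qed
  qed
qed

section \<open>Time slices of a control\<close>

lemma norm_L2_eq_nn_integral: "ennreal ((norm f)\<^sup>2) = (\<integral>\<^sup>+x. ennreal ((cmod (rep_L2 f x))\<^sup>2) \<partial>lebesgue)"
proof -
  have "integrable lebesgue (\<lambda>x. (cmod (rep_L2 f x))\<^sup>2)"
    using square_integrable_rep[of f] by (simp only: square_integrable_def)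
  then show ?thesis
    using norm_L2_of[OF square_integrable_rep, of f] by (simp add: nn_integral_eq_integral)
qed

text \<open>This is only an inequality because \<open>L2_of\<close> sends functions that are not square integrable to
  \<open>0\<close>.\<close>

lemma norm_L2_of_le_nn_integral:
  "ennreal ((norm (L2_of f))\<^sup>2) \<le> (\<integral>\<^sup>+x. ennreal ((cmod (f x))\<^sup>2) \<partial>lebesgue)"
proof (cases "square_integrable f")
  case True
  then have "integrable lebesgue (\<lambda>x. (cmod (f x))\<^sup>2)" by (simp only: square_integrable_def)
  then show ?thesis by (simp add: norm_L2_of[OF True] nn_integral_eq_integral)
next
  case False
  then have "L2_of f = 0" by (simp add: L2_of_def zero_L2_def)
  then show ?thesis by simp
qed

text \<open>This is Tonelli's theorem. Lebesgue measurability of the representative on space-time says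
  little about its slices, so the squared modulus is first replaced by a Borel function that
  agrees with it almost everywhere.\<close>

lemma nn_integral_time_slice_le:
  fixes u :: "(real \<times> 'a::euclidean_space) L2"
  shows "(\<integral>\<^sup>+s. ennreal ((norm (time_slice u s))\<^sup>2) \<partial>lebesgue) \<le> ennreal ((norm u)\<^sup>2)"
proof -
  have "(\<lambda>p. ennreal ((cmod (rep_L2 u p))\<^sup>2)) \<in> borel_measurable (completion lborel)"
    by measurable
  then obtain g where g: "g \<in> borel_measurable (lborel :: (real \<times> 'a) measure)"
    and eq: "AE p in lborel. ennreal ((cmod (rep_L2 u p))\<^sup>2) = g p"
    using completion_ex_borel_measurable by blast
  have g' [measurable]: "g \<in> borel_measurable (lborel \<Otimes>\<^sub>M lborel)"
    using g by (simp add: lborel_prod)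
  have "AE s in lborel. AE x in lborel. ennreal ((cmod (rep_L2 u (s, x)))\<^sup>2) = g (s, x)"
    using eq unfolding lborel_prod[symmetric] by (rule lborel_pair.AE_pair)
  then have "AE s in lborel. ennreal ((norm (time_slice u s))\<^sup>2) \<le> (\<integral>\<^sup>+x. g (s, x) \<partial>lborel)"
  proof eventually_elim
    case (elim s)
    have "ennreal ((norm (time_slice u s))\<^sup>2) \<le> (\<integral>\<^sup>+x. ennreal ((cmod (rep_L2 u (s, x)))\<^sup>2) \<partial>lebesgue)"
      unfolding time_slice_def by (rule norm_L2_of_le_nn_integral)
    also have "\<dots> = (\<integral>\<^sup>+x. g (s, x) \<partial>lborel)"
      unfolding nn_integral_completion using elim by (rule nn_integral_cong_AE)
    finally show ?case .
  qed
  then have "(\<integral>\<^sup>+s. ennreal ((norm (time_slice u s))\<^sup>2) \<partial>lborel) \<le> (\<integral>\<^sup>+s. (\<integral>\<^sup>+x. g (s, x) \<partial>lborel) \<partial>lborel)"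
    by (rule nn_integral_mono_AE)
  also have "\<dots> = (\<integral>\<^sup>+p. g p \<partial>(lborel \<Otimes>\<^sub>M lborel))"
    by (rule lborel.nn_integral_fst[OF g'])
  also have "\<dots> = (\<integral>\<^sup>+p. ennreal ((cmod (rep_L2 u p))\<^sup>2) \<partial>lborel)"
    unfolding lborel_prod using eq by (intro nn_integral_cong_AE) (auto elim: eventually_mono)
  also have "\<dots> = ennreal ((norm u)\<^sup>2)"
    by (simp add: norm_L2_eq_nn_integral nn_integral_completion)
  finally show ?thesis by (simp add: nn_integral_completion)
qed

lemma nn_integral_control_le:
  fixes u :: "(real \<times> 'a::euclidean_space) L2"
  assumes "A \<in> sets lebesgue"
  shows "(\<integral>\<^sup>+s. ennreal ((norm (restrict_L2 A (time_slice u s)))\<^sup>2) \<partial>lebesgue_on {0..T}) \<le> ennreal ((norm u)\<^sup>2)"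
proof -
  have "(\<integral>\<^sup>+s. ennreal ((norm (restrict_L2 A (time_slice u s)))\<^sup>2) \<partial>lebesgue_on {0..T})
      \<le> (\<integral>\<^sup>+s. ennreal ((norm (time_slice u s))\<^sup>2) \<partial>lebesgue)"
    by (subst nn_integral_restrict_space)
      (auto intro!: nn_integral_mono ennreal_leI power_mono norm_restrict_L2_le assms simp: indicator_def)
  also have "\<dots> \<le> ennreal ((norm u)\<^sup>2)" by (rule nn_integral_time_slice_le)
  finally show ?thesis .
qed

section \<open>Lack of exact controllability in average\<close>

lemma absolutely_continuous_rv_atomless:
  assumes "absolutely_continuous_rv M \<alpha>"
  shows "\<alpha> \<in> borel_measurable M" "AE \<omega> in M. \<alpha> \<omega> \<noteq> c"
proof -
  obtain \<rho> where \<rho>: "integrable lborel \<rho>" "distributed M lborel \<alpha> (\<lambda>x. ennreal (\<rho> x))"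
    using assms by (auto simp: absolutely_continuous_rv_def)
  show \<alpha>: "\<alpha> \<in> borel_measurable M"
    using distributed_measurable[OF \<rho>(2)] by simp
  have "AE x in density lborel (\<lambda>x. ennreal (\<rho> x)). x \<noteq> c"
    using AE_lborel_singleton[of c] \<rho>(1) by (subst AE_density) (auto elim: eventually_mono)
  then have "AE x in distr M lborel \<alpha>. x \<noteq> c"
    unfolding distributed_distr_eq_density[OF \<rho>(2)] .
  then show "AE \<omega> in M. \<alpha> \<omega> \<noteq> c"
    using \<alpha> by (subst (asm) AE_distr_iff) auto
qed

theorem theorem4p2:
  fixes M :: "'w measure" and \<alpha> :: "'w \<Rightarrow> real"
    and G G0 :: "(real ^ 'd) set" and T :: real
    and S :: "real \<Rightarrow> (real ^ 'd) L2 \<Rightarrow> (real ^ 'd) L2"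
  assumes "prob_space M"
    and "absolutely_continuous_rv M \<alpha>"
    and "bounded G" and "lipschitz_domain G"
    and "G0 \<subseteq> G" and "G0 \<in> sets lebesgue" and "emeasure lebesgue G0 > 0"
    and "T > 0"
    and "schroedinger_group G S"
  shows "\<not> exactly_controllable_in_average M \<alpha> S G G0 T"
proof
  assume "exactly_controllable_in_average M \<alpha> S G G0 T"
  then obtain C where C: "C > 0" and control:
    "\<And>y0 y1. y0 \<in> L2_on G \<Longrightarrow> y1 \<in> L2_on G \<Longrightarrow> \<exists>u\<in>L2_on ({0<..<T} \<times> G0).
        norm u \<le> C * (norm y0 + norm y1) \<and> average_solution M \<alpha> S G0 T y0 u = y1"
    unfolding exactly_controllable_in_average_def by blast
  have "open G" using assms(4) by (simp only: lipschitz_domain_def)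
  then have G: "G \<in> sets lebesgue" by simp
  have G0_meas: "G0 \<in> lmeasurable"
    using bounded_set_imp_lmeasurable[OF bounded_subset[OF assms(3,5)] assms(6)] .
  have unitary: "unitary_group_on (L2_on G) S" using assms(9) by (simp only: schroedinger_group_def)
  define U where "U = extend_group G S"
  interpret isometry_group U unfolding U_def by (rule isometry_group_extend_group[OF G unitary])
  have U_eq: "U t f = S t f" if "f \<in> L2_on G" for t f
    unfolding U_def by (rule extend_group_eq[OF G that])
  have zero_mem: "0 \<in> L2_on G" using G linear_0[OF linear_restrict_L2[OF G]] by (simp add: L2_on_iff_restrict_L2)
  \<comment> \<open>A nonzero element of the space: the indicator function of the control region.\<close>
  define f0 where "f0 = L2_ind 1 G0"
  have "norm (L2_ind 1 G0 - L2_ind 0 G0) = sqrt (measure lebesgue G0)"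
    using norm_L2_ind_diff2[OF G0_meas, of 1 0] by simp
  moreover have "measure lebesgue G0 > 0"
    using assms(7) G0_meas by (simp add: emeasure_eq_measure2)
  ultimately have "f0 \<noteq> 0" by (auto simp: f0_def L2_ind_def)
  moreover have "f0 \<in> L2_on G"
    unfolding f0_def L2_ind_def using square_integrable_indicator[OF G0_meas, of 1]
    by (rule L2_of_in_L2_on) (use assms(5) in \<open>auto simp: indicator_def\<close>)
  ultimately obtain \<psi> \<phi> :: "nat \<Rightarrow> (real ^ 'd) L2" where
    gen: "\<And>n. generates (\<psi> n) (\<phi> n)" and \<phi>: "\<And>n. \<phi> n \<in> L2_on G" "\<And>n. norm (\<phi> n) = 1"
    and \<psi>: "\<psi> \<longlonglongrightarrow> 0"
    using generator_unbounded[OF G assms(9)] unfolding U_def by blast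
  note \<alpha> = absolutely_continuous_rv_atomless[OF assms(2)]
  define I where "I n = (LINT s|lebesgue_on {0..T}. (norm (LINT \<omega>|M. U ((s - T) * \<alpha> \<omega>) (\<phi> n)))\<^sup>2)" for n
  have "I \<longlonglongrightarrow> 0"
    unfolding I_def using averaged_orbits_vanish[OF assms(1) \<alpha>(1) \<alpha>(2) gen \<phi>(2) \<psi>] assms(8) by simp
  have "1 \<le> C\<^sup>2 * I n" for n
  proof -
    obtain u where u: "norm u \<le> C" "average_solution M \<alpha> S G0 T 0 u = \<phi> n"
      using control[OF zero_mem \<phi>(1)[of n]] \<phi>(2)[of n] by auto
    define v where "v s = restrict_L2 G0 (time_slice u s)" for s
    have v_mem: "v s \<in> L2_on G" for s
      using restrict_L2_in_L2_on[OF assms(6)] L2_on_mono[OF assms(5)] unfolding v_def by blast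
    have "solution S G0 T \<xi> 0 u = (LINT s|lebesgue_on {0..T}. U ((T - s) * \<xi>) (v s))" for \<xi>
      using U_eq[OF zero_mem, of "T * \<xi>"] linear_0[OF linear]
      by (simp add: solution_def U_eq[OF v_mem] flip: v_def)
    then have avg: "(LINT \<omega>|M. LINT s|lebesgue_on {0..T}. U ((T - s) * \<alpha> \<omega>) (v s)) = \<phi> n"
      using u(2) by (simp add: average_solution_def)
    have "(\<integral>\<^sup>+s. ennreal ((norm (v s))\<^sup>2) \<partial>lebesgue_on {0..T}) \<le> ennreal ((norm u)\<^sup>2)"
      unfolding v_def by (rule nn_integral_control_le[OF assms(6)])
    also have "\<dots> \<le> ennreal (C\<^sup>2)" using u(1) by (intro ennreal_leI power_mono) auto
    \<comment> \<open>Young's inequality with \<open>\<epsilon> = 1 / C\<^sup>2\<close>: the control contributes at most half of the left side.\<close>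
    finally have "2 * (\<phi> n \<bullet> \<phi> n) \<le> 1 / C\<^sup>2 * C\<^sup>2 + I n / (1 / C\<^sup>2)"
      unfolding I_def using averaged_duality_bound[OF assms(1) \<alpha>(1), of T v "C\<^sup>2" "1 / C\<^sup>2" "\<phi> n"] C assms(8)
      by (simp add: avg)
    then show ?thesis
      using C \<phi>(2)[of n] by (simp add: power2_norm_eq_inner[symmetric] mult.commute)
  qed
  moreover have "(\<lambda>n. C\<^sup>2 * I n) \<longlonglongrightarrow> 0"
    using tendsto_mult_right_zero[OF \<open>I \<longlonglongrightarrow> 0\<close>] .
  ultimately have "(1::real) \<le> 0" by (intro LIMSEQ_le_const[of "\<lambda>n. C\<^sup>2 * I n"]) auto
  then show False by simp
qed

end
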